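(* Let $\mathcal{G}=(G,\lambda)$ be a temporal graph, where $G$ is either an undirected graph or a directed graph, and let $s,t\in V(G)$ be non-adjacent. (1) $tp(s,t)=1$ if and only if $tpc(s,t)=1$. (2) For each fixed integer $k\ge 2$ there exists a temporal graph $\mathcal{G}=(G,\lambda)$ (and also one whose underlying graph is directed) and non-adjacent $s,t\in V(G)$ such that $tpc(s,t)=k+tp(s,t)$.
   Context: A temporal graph with lifetime $\tau$ is a pair $(G,\lambda)$ where $G$ is a finite simple (undirected or directed) graph and $\lambda$ assigns to each edge (arc) a subset of $[\tau]=\{1,\dots,\tau\}$. A temporal vertex is an element of $V(G)\times[\tau]$. A (non-strict) temporal $s,t$-walk is a sequence $(s=v_1,t_1,v_2,t_2,\dots,t_{p-1},v_p=t)$ such that $v_iv_{i+1}\in E(G)$ (the arc $(v_i,v_{i+1})$ in the directed case), $t_i\in\lambda(v_iv_{i+1})$ for all $i<p$, and $t_1\le t_2\le\dots\le t_{p-1}$; it is a temporal $s,t$-path if $v_1,\dots,v_p$ are pairwise distinct. The set $V^T(P)$ of temporal vertices contained in such a $P$ consists of $(s,t_1)$, $(t,t_{p-1})$, and, for each $2\le i\le p-1$, all $(v_i,j)$ with $t_{i-1}\le j\le t_i$. Two temporal $s,t$-paths $P,Q$ are t-vertex disjoint if $V^T(P)\cap V^T(Q)\subseteq\{s,t\}\times[\tau]$. A t-vertex $s,t$-cut is a set $S\subseteq (V(G)\setminus\{s,t\})\times[\tau]$ with $S\cap V^T(P)\neq\emptyset$ for every temporal $s,t$-path $P$. $tp(s,t)$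 denotes the maximum number of pairwise t-vertex disjoint temporal $s,t$-paths, and $tpc(s,t)$ the minimum size of a t-vertex $s,t$-cut. *)

theory Defs
  imports "Graph_Theory.Pair_Digraph"
begin

text \<open>
  An undirected graph is represented, as usual in \<open>Graph_Theory\<close>, by the symmetric digraph
  (locale \<open>pair_graph\<close>) having both arcs \<open>(u, v)\<close> and \<open>(v, u)\<close> for every edge \<open>uv\<close>.
  The two arcs stand for one edge, so they must carry the same set of times.
  In a \<open>pair_digraph\<close> antiparallel arcs are allowed, with unrelated time sets.
\<close>

locale temporal_digraph = pair_digraph G
  for G :: "'a pair_pre_digraph" +
  fixes \<tau> :: nat and lam :: "'a \<times> 'a \<Rightarrow> nat set"
  assumes times: "\<And>e. e \<in> parcs G \<Longrightarrow> lam e \<subseteq> {1..\<tau>}"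

locale temporal_graph = pair_graph G
  for G :: "'a pair_pre_digraph" +
  fixes \<tau> :: nat and lam :: "'a \<times> 'a \<Rightarrow> nat set"
  assumes times: "\<And>e. e \<in> parcs G \<Longrightarrow> lam e \<subseteq> {1..\<tau>}"
    and times_sym: "\<And>u v. (u, v) \<in> parcs G \<Longrightarrow> lam (u, v) = lam (v, u)"

definition adjacent :: "'a pair_pre_digraph \<Rightarrow> 'a \<Rightarrow> 'a \<Rightarrow> bool" where
  "adjacent G u v \<longleftrightarrow> (u, v) \<in> parcs G \<or> (v, u) \<in> parcs G"

text \<open>
  The walk \<open>v\<^sub>1, t\<^sub>1, v\<^sub>2, \<dots>, t\<^sub>p\<^sub>-\<^sub>1, v\<^sub>p\<close> is the pair of
  lists \<open>([v\<^sub>1, \<dots>, v\<^sub>p], [t\<^sub>1, \<dots>, t\<^sub>p\<^sub>-\<^sub>1])\<close>; list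
  positions start at 0.
\<close>

type_synonym 'a twalk = "'a list \<times> nat list"

definition temporal_walk ::
  "'a pair_pre_digraph \<Rightarrow> ('a \<times> 'a \<Rightarrow> nat set) \<Rightarrow> 'a \<Rightarrow> 'a \<Rightarrow> 'a twalk \<Rightarrow> bool" where
  "temporal_walk G lam s t P \<longleftrightarrow> (case P of (vs, ts) \<Rightarrow>
     length vs = Suc (length ts) \<and> set vs \<subseteq> pverts G \<and> hd vs = s \<and> last vs = t \<and>
     (\<forall>i < length ts. (vs ! i, vs ! Suc i) \<in> parcs G \<and> ts ! i \<in> lam (vs ! i, vs ! Suc i)) \<and>
     sorted ts)"

definition temporal_path ::
  "'a pair_pre_digraph \<Rightarrow> ('a \<times> 'a \<Rightarrow> nat set) \<Rightarrow> 'a \<Rightarrow> 'a \<Rightarrow> 'a twalk \<Rightarrow> bool" where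
  "temporal_path G lam s t P \<longleftrightarrow> temporal_walk G lam s t P \<and> distinct (fst P)"

text \<open>
  \<open>VT P\<close> is only meaningful for walks with at least one edge; this covers all temporal paths
  between distinct vertices.
\<close>

definition VT :: "'a twalk \<Rightarrow> ('a \<times> nat) set" where
  "VT P = (case P of (vs, ts) \<Rightarrow>
     {(hd vs, hd ts), (last vs, last ts)} \<union>
     {(vs ! Suc i, j) | i j. Suc i < length ts \<and> ts ! i \<le> j \<and> j \<le> ts ! Suc i})"

definition t_vertex_disjoint :: "nat \<Rightarrow> 'a \<Rightarrow> 'a \<Rightarrow> 'a twalk \<Rightarrow> 'a twalk \<Rightarrow> bool" where
  "t_vertex_disjoint \<tau> s t P Q \<longleftrightarrow> VT P \<inter> VT Q \<subseteq> {s, t} \<times> {1..\<tau>}"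

definition t_vertex_cut ::
  "'a pair_pre_digraph \<Rightarrow> nat \<Rightarrow> ('a \<times> 'a \<Rightarrow> nat set) \<Rightarrow> 'a \<Rightarrow> 'a \<Rightarrow> ('a \<times> nat) set \<Rightarrow> bool" where
  "t_vertex_cut G \<tau> lam s t S \<longleftrightarrow>
     S \<subseteq> (pverts G - {s, t}) \<times> {1..\<tau>} \<and>
     (\<forall>P. temporal_path G lam s t P \<longrightarrow> S \<inter> VT P \<noteq> {})"

text \<open>
  For distinct non-adjacent \<open>s\<close> and \<open>t\<close> the two sets of cardinalities below are finite and
  nonempty: there are finitely many temporal paths, and all temporal vertices outside
  \<open>{s, t} \<times> {1..\<tau>}\<close> together form a cut.
\<close>

definition tp :: "'a pair_pre_digraph \<Rightarrow> nat \<Rightarrow> ('a \<times> 'a \<Rightarrow> nat set) \<Rightarrow> 'a \<Rightarrow> 'a \<Rightarrow> nat" where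
  "tp G \<tau> lam s t = Max {card F | F.
     (\<forall>P \<in> F. temporal_path G lam s t P) \<and> pairwise (t_vertex_disjoint \<tau> s t) F}"

definition tpc :: "'a pair_pre_digraph \<Rightarrow> nat \<Rightarrow> ('a \<times> 'a \<Rightarrow> nat set) \<Rightarrow> 'a \<Rightarrow> 'a \<Rightarrow> nat" where
  "tpc G \<tau> lam s t = Min {card S | S. t_vertex_cut G \<tau> lam s t S}"

end

theory Submission
  imports Defs
begin

text \<open>Work in the time-expanded digraph: from a temporal vertex one either waits one time unit
  at the same vertex or crosses an arc that carries the current time. A temporal path becomes a line
  that meets every column (all copies of one vertex) in a single run. Menger's theorem in this
  digraph is not enough: its disjoint lines may return to a column they have left, and waiting there
  instead may run into another line.

  For two lines this can be repaired. Suppose that no set of at most one temporal vertex is a cut.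
  Fix a path \<open>P\<close> and push along it a pair of lines that share no temporal vertex except
  in the column of \<open>s\<close> and at their common end \<open>b\<close> on \<open>P\<close>. A
  path \<open>Q\<close> avoiding \<open>b\<close> yields a detour from one of the lines to some
  \<open>z\<close> on \<open>P\<close> beyond \<open>b\<close> (\<open>fork_connect\<close>), while
  the other line follows \<open>P\<close> from \<open>b\<close> to \<open>z\<close>. Taking
  \<open>z\<close> as late as possible keeps the rest of \<open>P\<close> out of all columns in use
  other than that of \<open>z\<close> (\<open>fork_advance\<close>), so the step repeats
  (\<open>fork_step\<close>) until the column of \<open>t\<close> is reached
  (\<open>two_disjoint_tlines\<close>). After translation back to temporal paths,
  \<open>two_disjoint_paths\<close> shows that a cut number of at least 2 forces two disjoint paths;
  with the weak duality \<open>tp_le_tpc\<close> this gives \<open>tp_eq_1_iff\<close>.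

  For the gap, \<open>k\<close> independent blocks are put between source and sink.
  \<open>gap_path_cases\<close> describes every path well enough to compute \<open>tp\<close> as
  \<open>3 * k\<close> (\<open>tp_gap\<close>) and \<open>tpc\<close> as \<open>4 * k\<close>
  (\<open>tpc_gap\<close>).\<close>

section \<open>Contiguous lists of temporal vertices\<close>

text \<open>The counterpart of distinctness of path vertices once waiting is written out as
  repetition of the first component.\<close>

fun contig :: "('a \<times> 'b) list \<Rightarrow> bool" where
  "contig (x # y # zs) \<longleftrightarrow> contig (y # zs) \<and> (fst x \<noteq> fst y \<longrightarrow> fst x \<notin> fst ` set (y # zs))"
| "contig _ \<longleftrightarrow> True"

lemma contig_Cons:
  "contig (x # ys) \<longleftrightarrow> contig ys \<and> (\<forall>y \<in> set ys. fst x = fst y \<longrightarrow> fst (hd ys) = fst x)"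
  by (cases ys) auto

text \<open>A first component occurring in both parts must fill the list up to and across the
  junction, so it is the one at both sides of the junction.\<close>

lemma contig_append:
  "contig (xs @ ys) \<longleftrightarrow> contig xs \<and> contig ys \<and>
     (\<forall>x \<in> set xs. \<forall>y \<in> set ys. fst x = fst y \<longrightarrow> fst (last xs) = fst x \<and> fst (hd ys) = fst x)"
proof (induction xs)
  case (Cons x xs)
  show ?case
  proof (cases "xs = []")
    case True
    then show ?thesis by (auto simp: contig_Cons)
  next
    case False
    then have h: "hd (xs @ ys) = hd xs" "hd xs \<in> set xs" "last xs \<in> set xs" by auto
    let ?C = "\<lambda>x. \<forall>y \<in> set ys. fst x = fst y \<longrightarrow> fst (last xs) = fst x \<and> fst (hd ys) = fst x"
    have "(\<forall>y \<in> set xs \<union> set ys. fst x = fst y \<longrightarrow> fst (hd xs) = fst x) \<longleftrightarrow>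
          (\<forall>y \<in> set xs. fst x = fst y \<longrightarrow> fst (hd xs) = fst x) \<and> ?C x"
      if C: "\<forall>z \<in> set xs. ?C z"
      using bspec[OF C h(2)] h(3) by (metis Un_iff)
    then have "contig (x # (xs @ ys)) \<longleftrightarrow> contig xs \<and> contig ys \<and> (\<forall>z \<in> set xs. ?C z) \<and>
          (\<forall>y \<in> set xs. fst x = fst y \<longrightarrow> fst (hd xs) = fst x) \<and> ?C x"
      unfolding contig_Cons[of x "xs @ ys"] h(1) Cons.IH set_append by blast
    then show ?thesis using False by (auto simp: contig_Cons)
  qed
qed auto

section \<open>Lines in the time-expanded digraph\<close>

definition tstep :: "'a pair_pre_digraph \<Rightarrow> ('a \<times> 'a \<Rightarrow> nat set) \<Rightarrow> 'a \<times> nat \<Rightarrow> 'a \<times> nat \<Rightarrow> bool" where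
  "tstep G lam x y \<longleftrightarrow> fst y = fst x \<and> snd y = Suc (snd x) \<or>
     snd y = snd x \<and> (fst x, fst y) \<in> parcs G \<and> snd x \<in> lam (fst x, fst y)"

text \<open>
  Temporal paths with all waiting made explicit: a vertex, once left, is not visited again.
\<close>

definition tline :: "'a pair_pre_digraph \<Rightarrow> ('a \<times> 'a \<Rightarrow> nat set) \<Rightarrow> ('a \<times> nat) list \<Rightarrow> bool" where
  "tline G lam xs \<longleftrightarrow> successively (tstep G lam) xs \<and> contig xs"

lemma tline_append:
  assumes "xs \<noteq> []" "ys \<noteq> []"
  shows "tline G lam (xs @ ys) \<longleftrightarrow> tline G lam xs \<and> tline G lam ys \<and> tstep G lam (last xs) (hd ys) \<and>
     (\<forall>x \<in> set xs. \<forall>y \<in> set ys. fst x = fst y \<longrightarrow> fst (last xs) = fst x \<and> fst (hd ys) = fst x)"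
  using assms by (auto simp: tline_def contig_append successively_append_iff)

lemma tline_appendD:
  assumes "tline G lam (xs @ ys)"
  shows "tline G lam xs" "tline G lam ys"
  using assms by (auto simp: tline_def contig_append successively_append_iff)

lemma tline_append_column:
  assumes "tline G lam (xs @ ys)" "x \<in> set xs" "y \<in> set ys" "fst x = fst y"
  shows "fst (last xs) = fst x \<and> fst (hd ys) = fst x"
  using assms by (auto simp: tline_def contig_append)

lemma tline_between:
  assumes "tline G lam (xs @ z # ys)" "x \<in> set xs" "y \<in> set ys" "fst x = fst y"
  shows "fst z = fst x"
  using tline_append_column[of G lam "xs @ [z]" ys x y] assms by auto

lemma tline_mono:
  assumes "tline G lam (xs @ ys)" "x \<in> set xs" "y \<in> set ys"
  shows "snd x \<le> snd y"
proof -
  have "successively (\<lambda>x y. snd x \<le> snd y) (xs @ ys)"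
    using assms(1) unfolding tline_def by (auto elim: successively_mono simp: tstep_def)
  then have "sorted_wrt (\<lambda>x y. snd x \<le> snd y) (xs @ ys)"
    by (subst (asm) successively_conv_sorted_wrt) (auto intro: transpI)
  then show ?thesis using assms by (auto simp: sorted_wrt_append)
qed

text \<open>Waiting only adds vertices to the column of the last element, hence never breaks
  contiguity.\<close>

lemma tline_wait:
  assumes "tline G lam xs" "xs \<noteq> []" "last xs = (w, i)" "i \<le> n"
  shows "tline G lam (xs @ map (Pair w) [Suc i..<Suc n])"
    and "last (xs @ map (Pair w) [Suc i..<Suc n]) = (w, n)"
proof -
  let ?L = "\<lambda>n. xs @ map (Pair w) [Suc i..<Suc n]"
  have "tline G lam (?L n) \<and> last (?L n) = (w, n)"
    using assms(4)
  proof (induction n rule: dec_induct)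
    case base
    then show ?case using assms by simp
  next
    case (step m)
    have eq: "?L (Suc m) = ?L m @ [(w, Suc m)]" using step by simp
    have "tline G lam (?L m @ [(w, Suc m)])"
      using step assms by (subst tline_append) (auto simp: tline_def tstep_def)
    then show ?case unfolding eq by simp
  qed
  then show "tline G lam (?L n)" "last (?L n) = (w, n)" by auto
qed

context pair_digraph
begin

text \<open>By contiguity the step across the junction stays in the common column. Without loops it
  can only be a waiting step, and that increases the time.\<close>

lemma tline_strict_mono:
  assumes "tline G lam (xs @ ys)" "x \<in> set xs" "y \<in> set ys" "fst x = fst y"
  shows "snd x < snd y"
proof -
  have ne: "xs \<noteq> []" "ys \<noteq> []" using assms by auto
  have c: "fst (last xs) = fst x \<and> fst (hd ys) = fst x"
    using tline_append_column[OF assms] .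
  have "tstep G lam (last xs) (hd ys)" using assms(1) tline_append[OF ne] by blast
  then have "snd (last xs) < snd (hd ys)"
    using c no_loops' by (auto simp: tstep_def)
  moreover have "snd x \<le> snd (last xs)"
  proof (cases "x = last xs")
    case False
    then show ?thesis
      using tline_mono[of G lam "butlast xs" "[last xs]" x "last xs"] tline_appendD(1)[OF assms(1)]
        assms(2) ne(1) by (metis append_butlast_last_id list.set_intros(1) rotate1.simps(2) set_ConsD set_rotate1)
  qed simp
  moreover have "snd (hd ys) \<le> snd y"
  proof (cases "y = hd ys")
    case False
    then show ?thesis
      using tline_mono[of G lam "[hd ys]" "tl ys" "hd ys" y] tline_appendD(2)[OF assms(1)]
        assms(3) ne(2) by (metis append_Cons append_Nil list.collapse list.set_intros(1) set_ConsD)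
  qed simp
  ultimately show ?thesis by linarith
qed

text \<open>A column is visited in one run, and inside it every step waits exactly one unit, so no
  time is skipped.\<close>

lemma tline_interval:
  assumes "tline G lam xs" "(w, i) \<in> set xs" "(w, j) \<in> set xs" "i \<le> m" "m \<le> j"
  shows "(w, m) \<in> set xs"
  using assms
proof (induction xs arbitrary: i)
  case (Cons x xs)
  have t: "tline G lam xs" using Cons.prems(1) tline_appendD(2)[of G lam "[x]" xs] by simp
  show ?case
  proof (cases "(w, i) = x")
    case True
    show ?thesis
    proof (cases "m = i")
      case False
      then have j: "(w, j) \<in> set xs" using True Cons.prems by auto
      then have "xs \<noteq> []" by auto
      then have "tstep G lam x (hd xs)" "fst (hd xs) = w"
        using Cons.prems(1) tline_append[of "[x]" xs G lam] True j by auto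
      then have "hd xs = (w, Suc i)" using True no_loops' by (auto simp: tstep_def prod_eq_iff)
      then have "(w, Suc i) \<in> set xs" using \<open>xs \<noteq> []\<close> by (metis hd_in_set)
      then show ?thesis using Cons.IH[OF t _ j] False Cons.prems by auto
    qed (use True in auto)
  next
    case False
    then have i: "(w, i) \<in> set xs" using Cons.prems by auto
    show ?thesis
    proof (cases "(w, j) = x")
      case True
      then show ?thesis using tline_mono[of G lam "[x]" xs x "(w, i)"] i Cons.prems by auto
    next
      case False
      then show ?thesis using Cons.IH[OF t i] Cons.prems by auto
    qed
  qed
qed simp

section \<open>Augmentation of a pair of lines along a fixed path\<close>

section \<open>Two disjoint paths\<close>

text \<open>
  A single augmentation step: \<open>b\<close> lies on a fixed path whose remaining part is \<open>P\<close>, and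
  \<open>X @ [b]\<close>, \<open>Y @ [b]\<close> are disjoint up to their ends.  Following \<open>Q\<close>, which avoids \<open>b\<close>, until it
  first hits \<open>P\<close>, and going back from there to its last contact with a column of \<open>X\<close> or \<open>Y\<close>, a
  prefix \<open>A\<close> of \<open>X\<close> or \<open>Y\<close> is connected to \<open>P\<close> beyond \<open>b\<close>.
\<close>

lemma fork_connect:
  assumes P: "tline G lam (b # P)"
    and X: "tline G lam (X @ [b])" and Y: "tline G lam (Y @ [b])"
    and hX: "(s, 0) \<in> set X" and bs: "fst b \<noteq> s"
    and cols: "fst ` set P \<inter> fst ` (set X \<union> set Y) \<subseteq> {fst b}"
    and Q: "tline G lam Q" "Q \<noteq> []" "hd Q = (s, 0)" "b \<notin> set Q" "last Q \<in> set P"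
  obtains Z A B R M z N where "Z \<in> {X, Y}" "Z = A @ B" "A \<noteq> []" "P = M @ z # N"
    "tline G lam (A @ R @ [z])"
    "set R \<inter> (set X \<union> set Y \<union> set (b # P)) \<subseteq> {s} \<times> UNIV"
proof -
  let ?XY = "set X \<union> set Y"
  have colsD: "fst x = fst b" if "x \<in> set X \<union> set Y" "y \<in> set P" "fst x = fst y" for x y
  proof -
    have "fst x \<in> fst ` set P \<inter> fst ` (set X \<union> set Y)"
      using imageI[OF that(1), of fst] imageI[OF that(2), of fst] that(3) by simp
    then show ?thesis using cols by blast
  qed
  have "\<exists>x \<in> set Q. x \<in> set P" using Q last_in_set by blast
  then obtain Q0 z Q' where Qs: "Q = Q0 @ z # Q'" "z \<in> set P" "\<forall>y \<in> set Q0. y \<notin> set P"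
    using split_list_first_propE[of Q "\<lambda>x. x \<in> set P"] by metis
  have Q0z: "tline G lam (Q0 @ [z])" using Q(1) tline_appendD(1)[of G lam "Q0 @ [z]" Q'] Qs by simp
  have hP: "(s, 0) \<notin> set P" using colsD[of "(s, 0)" "(s, 0)"] hX bs by auto
  then have Q0: "Q0 \<noteq> []" "hd Q0 = (s, 0)" using Q(3) Qs by (auto simp: hd_append split: if_splits)
  \<comment> \<open>\<open>K y\<close> says that \<open>y\<close> can be reached from
    \<open>X\<close> or \<open>Y\<close> by waiting in its column. Vertices in the column of
    \<open>b\<close> from time \<open>snd b\<close> on are excluded, because waiting there may pass
    through \<open>b\<close>.\<close>
  define K where "K y \<longleftrightarrow> (\<exists>c \<in> ?XY. fst c = fst y \<and> snd c \<le> snd y) \<and>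
      \<not> (fst y = fst b \<and> snd b \<le> snd y)" for y
  have "K (s, 0)" unfolding K_def using hX bs by force
  then have "\<exists>y \<in> set Q0. K y" using Q0 by (metis hd_in_set)
  then obtain Q1 q Q2 where Q0s: "Q0 = Q1 @ q # Q2" "K q" "\<forall>y \<in> set Q2. \<not> K y"
    using split_list_last_propE[of Q0 K] by metis
  obtain w j where q: "q = (w, j)" by fastforce
  obtain c0 where "c0 \<in> ?XY \<and> fst c0 = w \<and> snd c0 \<le> j" using Q0s(2) q unfolding K_def by auto
  \<comment> \<open>The latest contact in the column of \<open>q\<close> is taken, so that the
    waiting segment from \<open>c\<close> to \<open>q\<close> meets neither \<open>X\<close> nor
    \<open>Y\<close>.\<close>
  then obtain c where c: "c \<in> ?XY" "fst c = w" "snd c \<le> j"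
    and cmax: "\<And>d. d \<in> ?XY \<Longrightarrow> fst d = w \<Longrightarrow> snd d \<le> j \<Longrightarrow> snd d \<le> snd c"
    using ex_has_greatest_nat[of "\<lambda>c. c \<in> ?XY \<and> fst c = w \<and> snd c \<le> j" c0 snd "Suc j"] by (metis le_imp_less_Suc)
  obtain Z where Z: "Z \<in> {X, Y}" "c \<in> set Z" using c by auto
  then obtain Z1 B where Zs: "Z = Z1 @ c # B" by (meson split_list)
  let ?A = "Z1 @ [c]"
  have Zb: "tline G lam (Z @ [b])" using X Y Z by auto
  have tA: "tline G lam ?A" using tline_appendD(1)[of G lam ?A "B @ [b]"] Zb Zs by simp
  define W where "W = map (Pair w) [Suc (snd c)..<Suc j]"
  have lA: "last ?A = (w, snd c)" using c by (simp add: prod_eq_iff)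
  have tAW: "tline G lam (?A @ W)" and lAW: "last (?A @ W) = q"
    unfolding W_def q using tline_wait[OF tA _ lA c(3)] by auto
  have tq: "tline G lam ([q] @ Q2 @ [z])"
    using tline_appendD(2)[of G lam Q1 "[q] @ Q2 @ [z]"] Q0z Q0s by simp
  have bQ: "b \<noteq> q" "b \<notin> set Q2" "b \<noteq> z" using Q(4) Qs Q0s by auto
  \<comment> \<open>\<open>Q\<close> cannot visit the column of \<open>b\<close> both before and after \<open>b\<close> without waiting through \<open>b\<close>.\<close>
  have nob: False if "w = fst b" "y \<in> set (Q2 @ [z])" "fst y = fst b" "snd b \<le> snd y" for y
  proof -
    have "j < snd b" using Q0s(2) q that by (auto simp: K_def)
    moreover have "tline G lam (q # Q2 @ [z])" using tq by simp
    moreover have "(fst b, j) \<in> set (q # Q2 @ [z])" using q that by simp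
    moreover have "(fst b, snd y) \<in> set (q # Q2 @ [z])"
      using that(2,3) by (metis list.set_intros(2) prod.collapse)
    ultimately have "(fst b, snd b) \<in> set (q # Q2 @ [z])"
      using tline_interval[of lam "q # Q2 @ [z]" "fst b" j "snd y" "snd b"] that by simp
    then show False using bQ by auto
  qed
  \<comment> \<open>A shared column would make \<open>y\<close> a later contact than
    \<open>q\<close>, unless \<open>y\<close> lies in the column of \<open>b\<close> at or after
    \<open>b\<close>. In that case contiguity of \<open>Z @ [b]\<close> puts the end of
    \<open>?A\<close>, and so \<open>q\<close>, into the column of \<open>b\<close>, which
    \<open>nob\<close> forbids.\<close>
  have cross: False if x: "x \<in> set ?A" and y: "y \<in> set (Q2 @ [z])" and xy: "fst x = fst y" for x y
  proof -
    have xXY: "x \<in> ?XY" using x Z Zs by auto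
    have xc: "snd x \<le> snd c"
      using tline_mono[of G lam Z1 "[c]" x c] tA x by auto
    have qy: "j \<le> snd y" using tline_mono[OF tq, of q y] y q by auto
    have yb: "fst y = fst b \<and> snd b \<le> snd y"
    proof (cases "y \<in> set Q2")
      case True
      then have "\<not> K y" using Q0s by blast
      moreover have "snd x \<le> snd y" using xc c qy by linarith
      ultimately show ?thesis unfolding K_def using xXY xy by blast
    next
      case False
      then have "y = z" using y by simp
      then have "fst y = fst b" using colsD[OF xXY] xy Qs(2) by simp
      moreover have "snd b \<le> snd y"
        using \<open>y = z\<close> tline_mono[of G lam "[b]" P b z] P Qs(2) by simp
      ultimately show ?thesis by simp
    qed
    then have wb: "w \<noteq> fst b" using nob y by blast
    have "fst (last ?A) = fst x"
      using tline_append_column[of G lam ?A "B @ [b]" x b] Zb Zs x xy yb by auto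
    then have "w = fst b" using c xy yb by simp
    with wb show False ..
  qed
  have "tline G lam ((?A @ W) @ (Q2 @ [z]))"
  proof (subst tline_append, simp, simp, intro conjI ballI impI)
    show "tline G lam (?A @ W)" by (rule tAW)
    show "tline G lam (Q2 @ [z])" using tq tline_appendD(2) by blast
    show "tstep G lam (last (?A @ W)) (hd (Q2 @ [z]))"
      using tq tline_append[of "[q]" "Q2 @ [z]" G lam] lAW by simp
    fix x y assume x: "x \<in> set (?A @ W)" and y: "y \<in> set (Q2 @ [z])" and xy: "fst x = fst y"
    then have "x \<in> set W" using cross[OF _ y xy] x by auto
    then have xq: "fst x = fst q" using q by (auto simp: W_def)
    then show "fst (last (?A @ W)) = fst x" using lAW by simp
    show "fst (hd (Q2 @ [z])) = fst x"
      using tline_append_column[OF tq, of q y] y xy xq by auto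
  qed
  moreover have "set (W @ Q2) \<inter> (?XY \<union> set (b # P)) \<subseteq> {}"
  proof -
    have "x \<notin> ?XY \<and> x \<notin> set (b # P)" if "x \<in> set W" for x
    proof -
      have x: "fst x = w" "snd c < snd x" "snd x \<le> j" using that by (auto simp: W_def)
      have "x \<notin> ?XY" using cmax x by fastforce
      moreover have "x \<notin> set (b # P)"
      proof
        assume a: "x \<in> set (b # P)"
        then have wb: "w = fst b" using colsD[of c x] c x by auto
        have "snd b \<le> snd x" using a tline_mono[of G lam "[b]" P b x] P by auto
        then show False using x wb Q0s(2) q by (auto simp: K_def)
      qed
      ultimately show ?thesis by blast
    qed
    moreover have "x \<notin> ?XY \<and> x \<notin> set (b # P)" if x2: "x \<in> set Q2" for x
    proof -
      \<comment> \<open>Since \<open>q\<close> is the last contact, an \<open>x\<close> on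
        \<open>X\<close> or \<open>Y\<close> would lie in the column of \<open>b\<close> no earlier
        than \<open>b\<close>. Lines ending in \<open>b\<close> are no later than \<open>b\<close>,
        so \<open>x = b\<close>, which \<open>Q\<close> avoids.\<close>
      have "x \<notin> ?XY"
      proof
        assume a: "x \<in> ?XY"
        then have "snd x \<le> snd b" using tline_mono[OF X, of x b] tline_mono[OF Y, of x b] by auto
        moreover have "fst x = fst b \<and> snd b \<le> snd x" using Q0s(3) x2 a unfolding K_def by blast
        ultimately show False using bQ x2 by (metis le_antisym prod_eq_iff)
      qed
      then show ?thesis using bQ x2 Qs(3) Q0s(1) by auto
    qed
    ultimately show ?thesis unfolding set_append by blast
  qed
  then have "set (W @ Q2) \<inter> (?XY \<union> set (b # P)) \<subseteq> {s} \<times> UNIV" by blast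
  moreover obtain M N where "P = M @ z # N" using Qs(2) by (meson split_list)
  ultimately show ?thesis by (intro that[of Z ?A B M z N "W @ Q2"]) (use Z(1) Zs in simp_all)
qed

text \<open>
  Connecting to the furthest possible \<open>z\<close> ensures that the new pair touches no column of the
  remaining part \<open>N\<close>, so that the augmentation can be iterated.
\<close>

lemma fork_advance:
  assumes P: "tline G lam (b # P)" and Ps: "P = M @ z # N"
    and X: "tline G lam (X @ [b])" and Y: "tline G lam (Y @ [b])"
    and hX: "(s, 0) \<in> set X" and bs: "fst b \<noteq> s"
    and disj: "set X \<inter> set Y \<subseteq> {s} \<times> UNIV"
    and cols: "fst ` set P \<inter> fst ` (set X \<union> set Y) \<subseteq> {fst b}"
    and A: "X = A @ B" "A \<noteq> []"
    and R: "tline G lam (A @ R @ [z])"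
      "set R \<inter> (set X \<union> set Y \<union> set (b # P)) \<subseteq> {s} \<times> UNIV"
    and furthest: "\<And>R' M' z' N'. P = M' @ z' # N' \<Longrightarrow> tline G lam (A @ R' @ [z']) \<Longrightarrow>
      set R' \<inter> (set X \<union> set Y \<union> set (b # P)) \<subseteq> {s} \<times> UNIV \<Longrightarrow> length N \<le> length N'"
  shows "tline G lam (Y @ b # M @ [z])"
    and "set (A @ R) \<inter> set (Y @ b # M) \<subseteq> {s} \<times> UNIV"
    and "fst ` set N \<inter> fst ` (set (A @ R) \<union> set (Y @ b # M)) \<subseteq> {fst z}"
proof -
  have colsD: "fst x = fst b" if "x \<in> set X \<union> set Y" "y \<in> set P" "fst x = fst y" for x y
  proof -
    have "fst x \<in> fst ` set P \<inter> fst ` (set X \<union> set Y)"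
      using imageI[OF that(1), of fst] imageI[OF that(2), of fst] that(3) by simp
    then show ?thesis using cols by blast
  qed
  have bMz: "tline G lam ([b] @ M @ [z])"
    using P Ps tline_appendD(1)[of G lam "[b] @ M @ [z]" N] by simp
  have "tline G lam ((Y @ [b]) @ (M @ [z]))"
  proof (subst tline_append, simp, simp, intro conjI ballI impI)
    show "tline G lam (Y @ [b])" by (rule Y)
    show "tline G lam (M @ [z])" using bMz tline_appendD(2) by blast
    show "tstep G lam (last (Y @ [b])) (hd (M @ [z]))"
      using bMz tline_append[of "[b]" "M @ [z]" G lam] by simp
    fix x y assume x: "x \<in> set (Y @ [b])" and y: "y \<in> set (M @ [z])" and xy: "fst x = fst y"
    have xb: "fst x = fst b"
      using colsD[of x y] x y xy Ps by (cases "x = b") auto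
    then show "fst (last (Y @ [b])) = fst x" by simp
    show "fst (hd (M @ [z])) = fst x"
      using tline_append_column[OF bMz, of b y] y xy xb by auto
  qed
  then show "tline G lam (Y @ b # M @ [z])" by simp
  \<comment> \<open>Returning to the column of \<open>b\<close> after \<open>z\<close> requires that
    \<open>z\<close> lies in it as well.\<close>
  have noN: "fst l \<noteq> fst b" if "l \<in> set N" "fst l \<noteq> fst z" for l
    using tline_between[of G lam "b # M" z N b l] P Ps that by auto
  show "set (A @ R) \<inter> set (Y @ b # M) \<subseteq> {s} \<times> UNIV"
  proof (rule subsetI)
    fix x assume x: "x \<in> set (A @ R) \<inter> set (Y @ b # M)"
    show "x \<in> {s} \<times> UNIV"
    proof (cases "x \<in> set R \<or> x \<in> set Y")
      case True
      then show ?thesis using x R(2) disj A Ps by auto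
    next
      case False
      then have xA: "x \<in> set A" and xP: "x \<in> set (b # M)" using x by auto
      have "fst x = fst b" using xA xP colsD[of x x] A Ps by auto
      moreover have "x \<in> set X" using xA A by simp
      ultimately have "snd x < snd b" using tline_strict_mono[OF X, of x b] by simp
      then have "x \<in> set M" using xP by auto
      then have "snd b \<le> snd x" using tline_mono[of G lam "[b]" P b x] P Ps by simp
      then show ?thesis using \<open>snd x < snd b\<close> by simp
    qed
  qed
  show "fst ` set N \<inter> fst ` (set (A @ R) \<union> set (Y @ b # M)) \<subseteq> {fst z}"
  proof (rule ccontr)
    assume "\<not> ?thesis"
    then obtain u where u: "u \<in> fst ` set N" "u \<in> fst ` (set (A @ R) \<union> set (Y @ b # M))" "u \<noteq> fst z"
      by blast
    obtain l0 where "l0 \<in> set N" "u = fst l0" using u(1) by (rule imageE)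
    moreover obtain x where x: "u = fst x" "x \<in> set (A @ R) \<union> set (Y @ b # M)" using u(2) by (rule imageE)
    ultimately have l0: "l0 \<in> set N" "fst l0 = fst x" "fst x \<noteq> fst z" using u(3) by simp_all
    have nxb: "fst x \<noteq> fst b" using noN l0 by metis
    have nXY: "fst y \<noteq> fst x" if "y \<in> set X \<union> set Y" for y
      using colsD[of y l0] that l0 nxb Ps by auto
    have nM: "fst y \<noteq> fst x" if "y \<in> set M" for y
      using tline_between[of G lam "b # M" z N y l0] P Ps l0 that by auto
    \<comment> \<open>Only the detour can touch a forbidden column. Waiting from \<open>x\<close> on
      the detour up to the first vertex \<open>l\<close> of \<open>N\<close> in that column then
      gives a connection beyond \<open>z\<close>, against \<open>furthest\<close>.\<close>
    have xR: "x \<in> set R" using x(2) nXY[of x] nM[of x] nxb A by auto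
    then obtain R1 R2 where Rs: "R = R1 @ x # R2" by (meson split_list)
    have "\<exists>l \<in> set N. fst l = fst x" using l0 by blast
    then obtain N1 l N2 where Ns: "N = N1 @ l # N2" "fst l = fst x" "\<forall>y \<in> set N1. \<not> fst y = fst x"
      by (rule split_list_first_propE)
    have xs: "fst x \<noteq> s" using nXY[of "(s, 0)"] hX by auto
    have "snd x \<le> snd z" using tline_mono[of G lam "A @ R" "[z]" x z] R(1) xR by simp
    moreover have "snd z \<le> snd l" using tline_mono[of G lam "b # M @ [z]" N z l] P Ps Ns by simp
    moreover have "x \<noteq> l" using xR R(2) Ns Ps xs by (cases x) auto
    ultimately have xl: "snd x < snd l" using Ns(2) by (metis le_trans nless_le prod_eq_iff)
    define w where "w = fst x"
    define W where "W = map (Pair w) [Suc (snd x)..<snd l]"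
    have "tline G lam (A @ R1 @ [x])"
      using R(1) Rs tline_appendD(1)[of G lam "A @ R1 @ [x]" "R2 @ [z]"] by simp
    then have "tline G lam ((A @ R1 @ [x]) @ map (Pair w) [Suc (snd x)..<Suc (snd l)])"
      using tline_wait(1)[of G lam "A @ R1 @ [x]" w "snd x" "snd l"] xl by (simp add: w_def)
    moreover have "map (Pair w) [Suc (snd x)..<Suc (snd l)] = W @ [l]"
      using xl Ns(2) by (simp add: W_def w_def prod_eq_iff)
    ultimately have new: "tline G lam (A @ (R1 @ x # W) @ [l])" by simp
    have "set W \<inter> (set X \<union> set Y \<union> set (b # P)) = {}"
    proof -
      have False if y: "y \<in> set W" and "y \<in> set X \<union> set Y \<union> set (b # P)" for y
      proof -
        have y': "fst y = fst x" "snd y < snd l" using y by (auto simp: W_def w_def)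
        \<comment> \<open>As \<open>l\<close> is the first vertex of \<open>N\<close> in this
          column, any hit lies behind \<open>l\<close> on \<open>P\<close>, hence not earlier than
          \<open>l\<close>; the waiting segment stops before \<open>l\<close>.\<close>
        then have "y \<in> set N2"
          using that nXY[of y] nM[of y] l0 nxb Ns Ps by auto
        then have "snd l \<le> snd y"
          using tline_mono[of G lam "b # M @ z # N1 @ [l]" N2 l y] P Ps Ns by simp
        then show False using y' by simp
      qed
      then show ?thesis by blast
    qed
    then have "set (R1 @ x # W) \<inter> (set X \<union> set Y \<union> set (b # P)) \<subseteq> {s} \<times> UNIV"
      using R(2) Rs by auto
    then have "length N \<le> length N2"
      using furthest[of "M @ z # N1" l N2 "R1 @ x # W"] new Ps Ns by simp
    then show False using Ns by simp
  qed
qed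

text \<open>Among all detours from prefixes of \<open>X\<close> or \<open>Y\<close>, one leaving the
  shortest remainder of \<open>P\<close> is chosen; \<open>fork_connect\<close> shows that some
  detour exists, and \<open>fork_advance\<close> applies to an extremal one.\<close>

lemma fork_step:
  assumes P: "tline G lam (b # P)"
    and X: "tline G lam (X @ [b])" and Y: "tline G lam (Y @ [b])"
    and hd: "hd (X @ [b]) = (s, 0)" "hd (Y @ [b]) = (s, 0)" and bs: "fst b \<noteq> s"
    and disj: "set X \<inter> set Y \<subseteq> {s} \<times> UNIV"
    and cols: "fst ` set P \<inter> fst ` (set X \<union> set Y) \<subseteq> {fst b}"
    and Q: "tline G lam Q" "Q \<noteq> []" "hd Q = (s, 0)" "b \<notin> set Q" "last Q \<in> set P"
  obtains M z N X' Y' where "P = M @ z # N" "tline G lam (X' @ [z])" "tline G lam (Y' @ [z])"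
    "hd (X' @ [z]) = (s, 0)" "hd (Y' @ [z]) = (s, 0)"
    "set X' \<inter> set Y' \<subseteq> {s} \<times> UNIV" "fst ` set N \<inter> fst ` (set X' \<union> set Y') \<subseteq> {fst z}"
proof -
  have ne: "X \<noteq> []" "Y \<noteq> []" using hd bs by auto
  then have hX: "(s, 0) \<in> set X" and hY: "(s, 0) \<in> set Y" using hd by (metis hd_append2 hd_in_set)+
  define conn where "conn Z A R M z N \<longleftrightarrow> Z \<in> {X, Y} \<and> (\<exists>B. Z = A @ B) \<and> A \<noteq> [] \<and>
    P = M @ z # N \<and> tline G lam (A @ R @ [z]) \<and>
    set R \<inter> (set X \<union> set Y \<union> set (b # P)) \<subseteq> {s} \<times> UNIV" for Z A R M z N
  define reach where "reach n \<longleftrightarrow> (\<exists>Z A R M z N. conn Z A R M z N \<and> length N = n)" for n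
  obtain Z\<^sub>0 A\<^sub>0 B\<^sub>0 R\<^sub>0 M\<^sub>0 z\<^sub>0 N\<^sub>0 where "Z\<^sub>0 \<in> {X, Y}" "Z\<^sub>0 = A\<^sub>0 @ B\<^sub>0" "A\<^sub>0 \<noteq> []"
    "P = M\<^sub>0 @ z\<^sub>0 # N\<^sub>0" "tline G lam (A\<^sub>0 @ R\<^sub>0 @ [z\<^sub>0])"
    "set R\<^sub>0 \<inter> (set X \<union> set Y \<union> set (b # P)) \<subseteq> {s} \<times> UNIV"
    using fork_connect[OF P X Y hX bs cols Q] .
  then have "reach (length N\<^sub>0)" unfolding reach_def conn_def by blast
  then have "reach (LEAST n. reach n)" by (rule LeastI)
  then obtain Z A R M z N where c: "conn Z A R M z N" and n: "length N = (LEAST n. reach n)"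
    unfolding reach_def by blast
  have min: "length N \<le> length N'" if "conn Z' A' R' M' z' N'" for Z' A' R' M' z' N'
    unfolding n by (rule Least_le) (use that in \<open>unfold reach_def, blast\<close>)
  obtain B where Z: "Z \<in> {X, Y}" "Z = A @ B" and A: "A \<noteq> []" and Ps: "P = M @ z # N"
    and R: "tline G lam (A @ R @ [z])" "set R \<inter> (set X \<union> set Y \<union> set (b # P)) \<subseteq> {s} \<times> UNIV"
    using c unfolding conn_def by auto
  \<comment> \<open>The line that continues through \<open>b\<close>. At the start of the iteration
    \<open>X\<close> and \<open>Y\<close> coincide, and then \<open>V\<close> is the same list as
    \<open>Z\<close>.\<close>
  define V where "V = (if Z = X then Y else X)"
  have VZ: "set X \<union> set Y = set Z \<union> set V" "set Z \<inter> set V \<subseteq> {s} \<times> UNIV"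
    "tline G lam (Z @ [b])" "tline G lam (V @ [b])" "(s, 0) \<in> set Z" "V \<noteq> []" "hd V = (s, 0)"
    "Z \<noteq> []" "hd Z = (s, 0)"
    using Z disj X Y hX hY ne hd by (auto simp: V_def)
  have m: "length N \<le> length N'" if "P = M' @ z' # N'" "tline G lam (A @ R' @ [z'])"
      "set R' \<inter> (set Z \<union> set V \<union> set (b # P)) \<subseteq> {s} \<times> UNIV" for R' M' z' N'
    using min[of Z A R' M' z' N'] that Z A unfolding conn_def VZ(1) by blast
  note adv = fork_advance[OF P Ps VZ(3,4,5) bs VZ(2) cols[unfolded VZ(1)] Z(2) A R(1) R(2)[unfolded VZ(1)] m]
  show ?thesis
  proof (rule that[OF Ps, of "A @ R" "V @ b # M"])
    show "hd ((A @ R) @ [z]) = (s, 0)" using A VZ(9) Z(2) by simp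
    show "hd ((V @ b # M) @ [z]) = (s, 0)" using VZ by simp
  qed (use adv R in auto)
qed

text \<open>Iteration of \<open>fork_step\<close> along \<open>P\<close>; every step shortens the
  part of \<open>P\<close> still ahead. The hypothesis \<open>avoid\<close> is the absence of a
  one-element cut among the vertices of \<open>P\<close>.\<close>

lemma two_disjoint_tlines:
  assumes P: "tline G lam P" "P \<noteq> []" "hd P = (s, 0)" "fst (last P) = t" and st: "s \<noteq> t"
    and avoid: "\<And>b. b \<in> set P \<Longrightarrow> fst b \<notin> {s, t} \<Longrightarrow>
      \<exists>Q. tline G lam Q \<and> Q \<noteq> [] \<and> hd Q = (s, 0) \<and> last Q = last P \<and> b \<notin> set Q"
  obtains X Y where "tline G lam X" "tline G lam Y" "X \<noteq> []" "Y \<noteq> []" "hd X = (s, 0)" "hd Y = (s, 0)"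
    "fst (last X) = t" "fst (last Y) = t" "set X \<inter> set Y \<subseteq> {s, t} \<times> UNIV"
proof -
  have "\<exists>X Y. tline G lam X \<and> tline G lam Y \<and> X \<noteq> [] \<and> Y \<noteq> [] \<and> hd X = (s, 0) \<and> hd Y = (s, 0) \<and>
      fst (last X) = t \<and> fst (last Y) = t \<and> set X \<inter> set Y \<subseteq> {s, t} \<times> UNIV"
    if "P = P1 @ b # P2" "fst b \<noteq> s" "tline G lam (X @ [b])" "tline G lam (Y @ [b])"
      "hd (X @ [b]) = (s, 0)" "hd (Y @ [b]) = (s, 0)" "set X \<inter> set Y \<subseteq> {s} \<times> UNIV"
      "fst ` set P2 \<inter> fst ` (set X \<union> set Y) \<subseteq> {fst b}" for P1 b P2 X Y
    using that
  proof (induction "length P2" arbitrary: P1 b P2 X Y rule: less_induct)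
    case less
    show ?case
    proof (cases "fst b = t")
      case True
      have "set (X @ [b]) \<inter> set (Y @ [b]) \<subseteq> {s, t} \<times> UNIV"
        using less.prems(7) True by (cases b) auto
      then show ?thesis using less.prems True
        by (intro exI[of _ "X @ [b]"] exI[of _ "Y @ [b]"]) auto
    next
      case False
      have P2: "P2 \<noteq> []" using False P(4) less.prems(1) by auto
      then have lP: "last P = last P2" "last P \<in> set P2" using less.prems(1) by auto
      obtain Q where Q: "tline G lam Q" "Q \<noteq> []" "hd Q = (s, 0)" "b \<notin> set Q" "last Q \<in> set P2"
        using avoid[of b] less.prems(1,2) False lP by auto
      have bP: "tline G lam (b # P2)" using P(1) less.prems(1) tline_appendD(2) by blast
      obtain M z N X' Y' where n: "P2 = M @ z # N" "tline G lam (X' @ [z])" "tline G lam (Y' @ [z])"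
        "hd (X' @ [z]) = (s, 0)" "hd (Y' @ [z]) = (s, 0)"
        "set X' \<inter> set Y' \<subseteq> {s} \<times> UNIV" "fst ` set N \<inter> fst ` (set X' \<union> set Y') \<subseteq> {fst z}"
        using fork_step[OF bP less.prems(3-6,2,7,8) Q] by metis
      \<comment> \<open>\<open>P\<close> has left the column of \<open>s\<close> before reaching
        \<open>b\<close>, so by contiguity the new meeting point \<open>z\<close> is not in that
        column.\<close>
      have "hd P1 = (s, 0)" "P1 \<noteq> []"
        using P(3) less.prems(1,2) by (auto simp: hd_append split: if_splits)
      then have "(s, 0) \<in> set P1" by (metis hd_in_set)
      then have "fst z \<noteq> s"
        using tline_between[of G lam P1 b P2 "(s, 0)" z] P(1) less.prems(1,2) n(1) by auto
      then show ?thesis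
        by (intro less.hyps[of N "P1 @ b # M" z X' Y']) (use n less.prems(1) in simp_all)
    qed
  qed
  note iterate = this
  have "\<exists>y \<in> set P. fst y \<noteq> s" using P st by (metis last_in_set)
  then obtain P1 b P2 where Ps: "P = P1 @ b # P2" "fst b \<noteq> s" "\<forall>y \<in> set P1. fst y = s"
    using split_list_first_propE[of P "\<lambda>y. fst y \<noteq> s"] by metis
  \<comment> \<open>Both initial lines are the waiting segment of \<open>P\<close> in the column of
    \<open>s\<close>; disjointness is only demanded outside this column.\<close>
  have "tline G lam (P1 @ [b])" using P Ps tline_appendD(1)[of G lam "P1 @ [b]" P2] by simp
  moreover have "hd (P1 @ [b]) = (s, 0)" using P(3) Ps by (cases P1) auto
  moreover have "fst ` set P2 \<inter> fst ` (set P1 \<union> set P1) \<subseteq> {fst b}"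
    using tline_between[of G lam P1 b P2] P(1) Ps by force
  moreover have "set P1 \<inter> set P1 \<subseteq> {s} \<times> UNIV" using Ps(3) by auto
  ultimately have "\<exists>X Y. tline G lam X \<and> tline G lam Y \<and> X \<noteq> [] \<and> Y \<noteq> [] \<and> hd X = (s, 0) \<and>
      hd Y = (s, 0) \<and> fst (last X) = t \<and> fst (last Y) = t \<and> set X \<inter> set Y \<subseteq> {s, t} \<times> UNIV"
    by (intro iterate[OF Ps(1,2), of P1 P1])
  then show ?thesis by (elim exE conjE) (rule that)
qed

end

section \<open>Translation between temporal paths and lines\<close>

section \<open>Temporal paths and their temporal vertices\<close>

lemma VT_single: "VT ([u, v], [a]) = {(u, a), (v, a)}"
  by (auto simp: VT_def)

text \<open>The tail contributes its own start \<open>(v, b)\<close>, which belongs to the whole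
  walk because \<open>a \<le> b\<close> places it in the waiting interval at
  \<open>v\<close>.\<close>

lemma VT_Cons:
  assumes "a \<le> b"
  shows "VT (u # v # vs, a # b # ts) = {(u, a)} \<union> {v} \<times> {a..b} \<union> VT (v # vs, b # ts)"
proof -
  have "{((u # v # vs) ! Suc i, j) | i j. Suc i < length (a # b # ts) \<and>
          (a # b # ts) ! i \<le> j \<and> j \<le> (a # b # ts) ! Suc i} =
        {v} \<times> {a..b} \<union>
        {((v # vs) ! Suc i, j) | i j. Suc i < length (b # ts) \<and>
          (b # ts) ! i \<le> j \<and> j \<le> (b # ts) ! Suc i}" (is "?L = ?M \<union> ?R")
  proof (intro equalityI subsetI)
    fix x assume "x \<in> ?L"
    then obtain i j where x: "x = ((u # v # vs) ! Suc i, j)" "Suc i < length (a # b # ts)"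
      "(a # b # ts) ! i \<le> j" "j \<le> (a # b # ts) ! Suc i" by auto
    then show "x \<in> ?M \<union> ?R" by (cases i) auto
  next
    fix x assume "x \<in> ?M \<union> ?R"
    then show "x \<in> ?L"
    proof
      assume "x \<in> ?M"
      then show "x \<in> ?L" by (intro CollectI exI[of _ 0] exI[of _ "snd x"]) auto
    next
      assume "x \<in> ?R"
      then obtain i j where "x = ((v # vs) ! Suc i, j)" "Suc i < length (b # ts)"
        "(b # ts) ! i \<le> j" "j \<le> (b # ts) ! Suc i" by auto
      then show "x \<in> ?L" by (intro CollectI exI[of _ "Suc i"] exI[of _ j]) auto
    qed
  qed
  then show ?thesis using assms by (auto simp: VT_def)
qed

lemma temporal_walk_Cons:
  "temporal_walk G lam s t (u # v # vs, a # ts) \<longleftrightarrow> u = s \<and> u \<in> pverts G \<and> (u, v) \<in> parcs G \<and>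
     a \<in> lam (u, v) \<and> (\<forall>b \<in> set ts. a \<le> b) \<and> temporal_walk G lam v t (v # vs, ts)"
  by (auto simp: temporal_walk_def All_less_Suc2)

lemma temporal_walk_Nil: "temporal_walk G lam s t ([u], []) \<longleftrightarrow> u = s \<and> u = t \<and> u \<in> pverts G"
  by (auto simp: temporal_walk_def)

lemma temporal_walk_ConsE:
  assumes "temporal_walk G lam s t P" "s \<noteq> t"
  obtains v vs a ts where "P = (s # v # vs, a # ts)"
proof -
  obtain vs ts where P: "P = (vs, ts)" by fastforce
  have vs: "length vs = Suc (length ts)" "hd vs = s" "last vs = t"
    using assms P by (auto simp: temporal_walk_def)
  then obtain vs' where vs': "vs = s # vs'" by (cases vs) auto
  then have "vs' \<noteq> []" using vs assms(2) by auto
  then obtain v vs'' where "vs' = v # vs''" by (cases vs') auto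
  then show ?thesis using that vs vs' P by (cases ts) auto
qed

context pair_digraph
begin

text \<open>Waiting is inserted everywhere, also before departure and after arrival, so that all
  lines can be given the same two ends. Apart from the padding in the columns of \<open>u\<close>
  and \<open>t\<close>, nothing outside \<open>VT\<close> is used.\<close>

lemma tline_of_temporal_path:
  assumes "temporal_path G lam u t (vs, ts)" "\<forall>a \<in> set ts. i \<le> a \<and> a \<le> n" "i \<le> n"
  shows "\<exists>xs. tline G lam xs \<and> xs \<noteq> [] \<and> hd xs = (u, i) \<and> last xs = (t, n) \<and> fst ` set xs \<subseteq> set vs \<and>
    (\<forall>x \<in> set xs. fst x = t \<or> fst x = u \<and> snd x \<le> hd ts \<or> x \<in> VT (vs, ts))"
  using assms
proof (induction ts arbitrary: u vs i)
  case Nil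
  then have "length vs = 1" "hd vs = u" "last vs = t"
    by (auto simp: temporal_path_def temporal_walk_def)
  then have vs: "vs = [t]" "u = t" by (cases vs; auto)+
  let ?xs = "[(t, i)] @ map (Pair t) [Suc i..<Suc n]"
  have "tline G lam [(t, i)]" by (simp add: tline_def)
  then have "tline G lam ?xs \<and> last ?xs = (t, n)"
    using tline_wait[of G lam "[(t, i)]" t i n] Nil by auto
  then show ?case using vs by (intro exI[of _ ?xs]) auto
next
  case (Cons a ts)
  have w: "temporal_walk G lam u t (vs, a # ts)" and d: "distinct vs"
    using Cons.prems by (auto simp: temporal_path_def)
  obtain v vs' where vs: "vs = u # v # vs'"
    using w by (auto simp: temporal_walk_def length_Suc_conv)
  have wv: "temporal_walk G lam v t (v # vs', ts)" and st: "(u, v) \<in> parcs G" "a \<in> lam (u, v)"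
    and mono: "\<forall>b \<in> set ts. a \<le> b"
    using w vs by (auto simp: temporal_walk_Cons)
  have "temporal_path G lam v t (v # vs', ts)" using wv d vs by (simp add: temporal_path_def)
  then obtain xs where xs: "tline G lam xs" "xs \<noteq> []" "hd xs = (v, a)" "last xs = (t, n)"
      "fst ` set xs \<subseteq> set (v # vs')"
      "\<forall>x \<in> set xs. fst x = t \<or> fst x = v \<and> snd x \<le> hd ts \<or> x \<in> VT (v # vs', ts)"
    using Cons.IH[of v "v # vs'" a] Cons.prems mono by auto
  let ?ws = "[(u, i)] @ map (Pair u) [Suc i..<Suc a]"
  have "tline G lam [(u, i)]" by (simp add: tline_def)
  then have ws: "tline G lam ?ws" "last ?ws = (u, a)"
    using tline_wait[of G lam "[(u, i)]" u i a] Cons.prems by auto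
  have uws: "fst x = u \<and> snd x \<le> a" if "x \<in> set ?ws" for x
    using that Cons.prems by auto
  have u: "u \<notin> fst ` set xs" using xs(5) d vs by auto
  have "tline G lam (?ws @ xs)"
  proof (subst tline_append, simp, rule xs(2), intro conjI ballI impI)
    show "tline G lam ?ws" "tline G lam xs" by fact+
    show "tstep G lam (last ?ws) (hd xs)" unfolding ws xs(3) tstep_def using st by simp
    fix x y assume xy: "x \<in> set ?ws" "y \<in> set xs" "fst x = fst y"
    then have False using u uws[OF xy(1)] imageI[OF xy(2), of fst] by simp
    then show "fst (last ?ws) = fst x" "fst (hd xs) = fst x" by blast+
  qed
  moreover have "fst x = t \<or> x \<in> VT (vs, a # ts)" if x: "x \<in> set xs" for x
  proof (cases ts)
    case Nil
    then have "vs' = []" using wv by (auto simp: temporal_walk_def)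
    then have "v = t" using wv by (auto simp: temporal_walk_def)
    then show ?thesis using xs(5) x \<open>vs' = []\<close> by auto
  next
    case (Cons b ts')
    have "snd (hd xs) \<le> snd x"
      using tline_mono[of G lam "[hd xs]" "tl xs" "hd xs" x] xs(1,2) x by (cases xs) auto
    then have "fst x = t \<or> x \<in> {v} \<times> {a..b} \<or> x \<in> VT (v # vs', ts)"
      using xs(3,6) x Cons by (cases x) auto
    then show ?thesis using VT_Cons[of a b u v vs' ts'] mono Cons vs by auto
  qed
  moreover have "fst ` set (?ws @ xs) \<subseteq> set vs" using xs(5) vs by auto
  moreover have "last (?ws @ xs) = (t, n)" using xs(2,4) by simp
  moreover have "\<forall>x \<in> set ?ws. fst x = u \<and> snd x \<le> hd (a # ts)" using uws by simp
  ultimately show ?case by (intro exI[of _ "?ws @ xs"]) (simp add: ball_Un; blast)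
qed

text \<open>Waiting steps are dropped and the time of each crossing is kept. By
  \<open>tline_interval\<close> the line contains the whole stay at each inner vertex, so no new
  temporal vertices appear.\<close>

lemma temporal_path_of_tline:
  assumes "tline G lam xs" "xs \<noteq> []" "fst (last xs) = t" "t \<in> pverts G"
  shows "\<exists>vs ts. temporal_path G lam (fst (hd xs)) t (vs, ts) \<and> set vs = fst ` set xs \<and>
    (\<forall>a \<in> set ts. snd (hd xs) \<le> a) \<and> (ts \<noteq> [] \<longrightarrow> VT (vs, ts) \<subseteq> set xs)"
  using assms
proof (induction xs)
  case (Cons x xs)
  show ?case
  proof (cases "xs = []")
    case True
    then show ?thesis using Cons.prems
      by (intro exI[of _ "[t]"] exI[of _ "[]"]) (auto simp: temporal_path_def temporal_walk_def)
  next
    case False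
    then have xs: "tline G lam xs" "tstep G lam x (hd xs)"
      and col: "\<And>y. y \<in> set xs \<Longrightarrow> fst x = fst y \<Longrightarrow> fst (hd xs) = fst x"
      using Cons.prems(1) tline_append[of "[x]" xs G lam] by auto
    obtain vs ts where IH: "temporal_path G lam (fst (hd xs)) t (vs, ts)" "set vs = fst ` set xs"
      "\<forall>a \<in> set ts. snd (hd xs) \<le> a" "ts \<noteq> [] \<longrightarrow> VT (vs, ts) \<subseteq> set xs"
      using Cons.IH[OF xs(1) False] Cons.prems False by auto
    have hx: "hd xs \<in> set xs" using False by simp
    show ?thesis
    proof (cases "fst (hd xs) = fst x")
      case True
      then have "set vs = fst ` set (x # xs)" using IH(2) hx by (auto intro: image_eqI[OF _ hx])
      moreover have "snd x \<le> snd (hd xs)" using xs(2) by (auto simp: tstep_def)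
      ultimately show ?thesis using IH True
        by (intro exI[of _ vs] exI[of _ ts]) auto
    next
      case F: False
      then have st: "snd (hd xs) = snd x" "(fst x, fst (hd xs)) \<in> parcs G"
        "snd x \<in> lam (fst x, fst (hd xs))"
        using xs(2) by (auto simp: tstep_def)
      have xn: "fst x \<notin> set vs" using IH(2) col F by auto
      obtain vs' where vs: "vs = fst (hd xs) # vs'"
        using IH(1) by (cases vs) (auto simp: temporal_path_def temporal_walk_def)
      have "temporal_path G lam (fst x) t (fst x # vs, snd x # ts)"
        using IH(1,3) st xn in_arcsD1 unfolding temporal_path_def vs
        by (auto simp: temporal_walk_Cons)
      moreover have "VT (fst x # vs, snd x # ts) \<subseteq> set (x # xs)"
      proof (cases ts)
        case Nil
        then have "vs' = []" using IH(1) vs by (auto simp: temporal_path_def temporal_walk_def)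
        moreover have "(fst (hd xs), snd x) = hd xs" using st by (simp add: prod_eq_iff)
        ultimately show ?thesis using Nil vs hx by (simp add: VT_single)
      next
        case ts: (Cons b ts')
        have b: "snd x \<le> b" using IH(3) ts st by simp
        have VTs: "VT (vs, ts) \<subseteq> set xs" using IH(4) ts by simp
        have "(fst (hd xs), b) \<in> VT (vs, ts)" using ts vs by (simp add: VT_def)
        then have "(fst (hd xs), b) \<in> set xs" using VTs by blast
        moreover have "(fst (hd xs), snd x) \<in> set xs" using hx st by (metis prod.collapse)
        ultimately have "(fst (hd xs), m) \<in> set xs" if "m \<in> {snd x..b}" for m
          using tline_interval[OF xs(1), of "fst (hd xs)" "snd x" b m] that by simp
        then have "{fst (hd xs)} \<times> {snd x..b} \<subseteq> set xs" by blast
        then show ?thesis using VTs b unfolding vs ts by (auto simp: VT_Cons)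
      qed
      ultimately show ?thesis using IH st
        by (intro exI[of _ "fst x # vs"] exI[of _ "snd x # ts"]) auto
    qed
  qed
qed simp

end

section \<open>Weak duality, and its converse at value one\<close>

section \<open>Packings and cuts\<close>

definition path_packing ::
  "'a pair_pre_digraph \<Rightarrow> nat \<Rightarrow> ('a \<times> 'a \<Rightarrow> nat set) \<Rightarrow> 'a \<Rightarrow> 'a \<Rightarrow> 'a twalk set \<Rightarrow> bool" where
  "path_packing G \<tau> lam s t F \<longleftrightarrow>
     (\<forall>P \<in> F. temporal_path G lam s t P) \<and> pairwise (t_vertex_disjoint \<tau> s t) F"

locale temporal_st = temporal_digraph G \<tau> lam
  for G :: "'a pair_pre_digraph" and \<tau> lam +
  fixes s t :: 'a
  assumes s_vert: "s \<in> pverts G" and t_vert: "t \<in> pverts G"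
    and s_neq_t: "s \<noteq> t" and not_adj: "\<not> adjacent G s t"
begin

lemma times_path:
  assumes "temporal_path G lam s t (vs, ts)"
  shows "set ts \<subseteq> {1..\<tau>}"
proof -
  have "ts ! i \<in> {1..\<tau>}" if "i < length ts" for i
    using assms that times[of "(vs ! i, vs ! Suc i)"]
    by (fastforce simp: temporal_path_def temporal_walk_def)
  then show ?thesis by (auto simp: in_set_conv_nth)
qed

lemma finite_paths: "finite {P. temporal_path G lam s t P}"
proof (rule finite_subset)
  let ?V = "{vs. set vs \<subseteq> pverts G \<and> length vs \<le> card (pverts G)}"
  let ?T = "{ts. set ts \<subseteq> {1..\<tau>} \<and> length ts \<le> card (pverts G)}"
  show "finite (?V \<times> ?T)"
    using pair_finite_verts by (intro finite_cartesian_product finite_lists_length_le) auto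
  show "{P. temporal_path G lam s t P} \<subseteq> ?V \<times> ?T"
  proof
    fix P assume "P \<in> {P. temporal_path G lam s t P}"
    moreover obtain vs ts where P: "P = (vs, ts)" by fastforce
    ultimately have p: "temporal_path G lam s t (vs, ts)" by simp
    then have "set vs \<subseteq> pverts G" "distinct vs" "length vs = Suc (length ts)"
      by (auto simp: temporal_path_def temporal_walk_def)
    then have "length vs \<le> card (pverts G)" "length ts \<le> length vs"
      using pair_finite_verts distinct_card[of vs] card_mono[of "pverts G" "set vs"] by auto
    then show "P \<in> ?V \<times> ?T" using \<open>set vs \<subseteq> pverts G\<close> times_path[OF p] P by auto
  qed
qed

lemma VT_subset:
  assumes "temporal_path G lam s t P"
  shows "VT P \<subseteq> pverts G \<times> {1..\<tau>}"
proof -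
  obtain v vs a ts where P: "P = (s # v # vs, a # ts)"
    using assms temporal_walk_ConsE s_neq_t unfolding temporal_path_def by metis
  let ?vs = "s # v # vs" and ?ts = "a # ts"
  have T: "set ?ts \<subseteq> {1..\<tau>}" using times_path[of "s # v # vs" "a # ts"] assms P by simp
  have V: "set ?vs \<subseteq> pverts G" "length ?vs = Suc (length ?ts)"
    using assms P by (auto simp: temporal_path_def temporal_walk_def)
  have "hd ?vs \<in> pverts G" "last ?vs \<in> pverts G"
    using V(1) last_in_set[of ?vs] by auto
  moreover have "hd ?ts \<in> {1..\<tau>}" "last ?ts \<in> {1..\<tau>}"
    using T last_in_set[of ?ts] by auto
  moreover have "?vs ! Suc i \<in> pverts G \<and> j \<in> {1..\<tau>}"
    if "Suc i < length ?ts" "?ts ! i \<le> j" "j \<le> ?ts ! Suc i" for i j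
  proof -
    have "?ts ! i \<in> {1..\<tau>}" "?ts ! Suc i \<in> {1..\<tau>}"
      using that(1) by (intro subsetD[OF T] nth_mem; simp)+
    moreover have "?vs ! Suc i \<in> set ?vs" using that(1) V(2) by (intro nth_mem) simp
    ultimately show ?thesis using that V(1) by auto
  qed
  ultimately show ?thesis unfolding P VT_def by auto
qed

text \<open>Non-adjacency forces an intermediate vertex. Hence a cut exists, and disjoint paths are
  distinct.\<close>

lemma VT_inner:
  assumes "temporal_path G lam s t P"
  shows "VT P - {s, t} \<times> {1..\<tau>} \<noteq> {}"
proof -
  obtain v vs a ts where P: "P = (s # v # vs, a # ts)"
    using assms temporal_walk_ConsE s_neq_t unfolding temporal_path_def by metis
  have w: "temporal_walk G lam v t (v # vs, ts)" "(s, v) \<in> parcs G" "s \<noteq> v" "a \<in> lam (s, v)"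
    "\<forall>b \<in> set ts. a \<le> b"
    using assms P by (auto simp: temporal_path_def temporal_walk_Cons)
  then have "v \<noteq> t" using not_adj by (auto simp: adjacent_def)
  then obtain b ts' where "ts = b # ts'" using temporal_walk_ConsE[OF w(1)] by blast
  then have "(v, a) \<in> VT P" using P w(5) by (simp add: VT_Cons)
  then show ?thesis using \<open>v \<noteq> t\<close> w(3) by blast
qed

lemma cut_all: "t_vertex_cut G \<tau> lam s t ((pverts G - {s, t}) \<times> {1..\<tau>})"
  using VT_inner VT_subset by (fastforce simp: t_vertex_cut_def)

lemma finite_cut: "t_vertex_cut G \<tau> lam s t S \<Longrightarrow> finite S"
  by (rule finite_subset[of _ "(pverts G - {s, t}) \<times> {1..\<tau>}"])
    (auto simp: t_vertex_cut_def pair_finite_verts)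

lemma finite_cut_cards: "finite {card S | S. t_vertex_cut G \<tau> lam s t S}"
proof (rule finite_subset)
  show "{card S | S. t_vertex_cut G \<tau> lam s t S} \<subseteq> card ` Pow ((pverts G - {s, t}) \<times> {1..\<tau>})"
    by (auto simp: t_vertex_cut_def)
  show "finite (card ` Pow ((pverts G - {s, t}) \<times> {1..\<tau>}))"
    using pair_finite_verts by auto
qed

lemma tpc_le: "t_vertex_cut G \<tau> lam s t S \<Longrightarrow> tpc G \<tau> lam s t \<le> card S"
  unfolding tpc_def using finite_cut_cards by (intro Min_le) auto

lemma tpc_cut: obtains S where "t_vertex_cut G \<tau> lam s t S" "card S = tpc G \<tau> lam s t"
proof -
  have "tpc G \<tau> lam s t \<in> {card S | S. t_vertex_cut G \<tau> lam s t S}"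
    unfolding tpc_def using finite_cut_cards cut_all by (intro Min_in) blast+
  then show ?thesis using that by auto
qed

lemma finite_packing_cards: "finite {card F | F. path_packing G \<tau> lam s t F}"
proof (rule finite_subset)
  show "{card F | F. path_packing G \<tau> lam s t F} \<subseteq> card ` Pow {P. temporal_path G lam s t P}"
    by (auto simp: path_packing_def)
  show "finite (card ` Pow {P. temporal_path G lam s t P})" using finite_paths by auto
qed

lemma tp_ge: "path_packing G \<tau> lam s t F \<Longrightarrow> card F \<le> tp G \<tau> lam s t"
  unfolding tp_def path_packing_def[symmetric] using finite_packing_cards by (intro Max_ge) auto

lemma tp_packing: obtains F where "path_packing G \<tau> lam s t F" "card F = tp G \<tau> lam s t"
proof -
  have "path_packing G \<tau> lam s t {}" by (simp add: path_packing_def)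
  then have "tp G \<tau> lam s t \<in> {card F | F. path_packing G \<tau> lam s t F}"
    unfolding tp_def path_packing_def[symmetric] using finite_packing_cards by (intro Max_in) blast+
  then show ?thesis using that by auto
qed

lemma finite_packing: "path_packing G \<tau> lam s t F \<Longrightarrow> finite F"
  by (rule finite_subset[OF _ finite_paths]) (auto simp: path_packing_def)

text \<open>Each packed path is sent to a cut element on it; disjointness off \<open>s\<close> and
  \<open>t\<close> makes this choice injective.\<close>

lemma tp_le_tpc: "tp G \<tau> lam s t \<le> tpc G \<tau> lam s t"
proof -
  obtain F where F: "path_packing G \<tau> lam s t F" "card F = tp G \<tau> lam s t" by (rule tp_packing)
  obtain S where S: "t_vertex_cut G \<tau> lam s t S" "card S = tpc G \<tau> lam s t" by (rule tpc_cut)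
  have "\<forall>P \<in> F. \<exists>x. x \<in> S \<inter> VT P"
    using F(1) S(1) unfolding path_packing_def t_vertex_cut_def by blast
  then obtain f where f: "\<forall>P \<in> F. f P \<in> S \<inter> VT P" by metis
  have "inj_on f F"
  proof (rule inj_onI, rule ccontr)
    fix P Q assume PQ: "P \<in> F" "Q \<in> F" "f P = f Q" "P \<noteq> Q"
    then have "VT P \<inter> VT Q \<subseteq> {s, t} \<times> {1..\<tau>}"
      using F(1) by (auto simp: path_packing_def pairwise_def t_vertex_disjoint_def)
    moreover have "f P \<in> VT P \<inter> VT Q" using f PQ by fastforce
    moreover have "f P \<in> (pverts G - {s, t}) \<times> {1..\<tau>}"
      using f PQ(1) S(1) by (auto simp: t_vertex_cut_def)
    ultimately show False by auto
  qed
  then have "card F \<le> card S" using f finite_cut[OF S(1)] by (intro card_inj_on_le[of f]) auto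
  then show ?thesis using F S by simp
qed

lemma two_disjoint_paths:
  assumes "2 \<le> tpc G \<tau> lam s t"
  shows "2 \<le> tp G \<tau> lam s t"
proof -
  have no_cut: "\<not> t_vertex_cut G \<tau> lam s t S" if "card S \<le> 1" for S
    using tpc_le that assms by fastforce
  \<comment> \<open>All labels lie in \<open>{1..\<tau>}\<close>, so waiting from time 0 and until
    \<open>\<tau>\<close> gives all paths the common ends \<open>(s, 0)\<close> and
    \<open>(t, \<tau>)\<close>.\<close>
  define expands where "expands P xs \<longleftrightarrow> tline G lam xs \<and> xs \<noteq> [] \<and> hd xs = (s, 0) \<and> last xs = (t, \<tau>) \<and>
      (\<forall>x \<in> set xs. fst x \<in> {s, t} \<or> x \<in> VT P)" for P xs
  have expand: "\<exists>xs. expands P xs" if P: "temporal_path G lam s t P" for P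
    using tline_of_temporal_path[of lam s t "fst P" "snd P" 0 \<tau>] P times_path[of "fst P" "snd P"]
    unfolding expands_def by fastforce
  have "\<not> t_vertex_cut G \<tau> lam s t {}" by (rule no_cut) simp
  then obtain P where P: "temporal_path G lam s t P" by (auto simp: t_vertex_cut_def)
  obtain xs where xs: "expands P xs" using expand P by blast
  have avoid: "\<exists>Q. tline G lam Q \<and> Q \<noteq> [] \<and> hd Q = (s, 0) \<and> last Q = last xs \<and> b \<notin> set Q"
    if b: "b \<in> set xs" "fst b \<notin> {s, t}" for b
  proof -
    have "b \<in> VT P" using xs b unfolding expands_def by blast
    then have "{b} \<subseteq> (pverts G - {s, t}) \<times> {1..\<tau>}" using VT_subset[OF P] b(2) by auto
    then obtain Q where Q: "temporal_path G lam s t Q" "b \<notin> VT Q"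
      using no_cut[of "{b}"] by (auto simp: t_vertex_cut_def)
    then obtain ys where "expands Q ys" using expand by blast
    then show ?thesis using xs Q b unfolding expands_def by (intro exI[of _ ys]) auto
  qed
  obtain X Y where XY: "tline G lam X" "tline G lam Y" "X \<noteq> []" "Y \<noteq> []" "hd X = (s, 0)" "hd Y = (s, 0)"
    "fst (last X) = t" "fst (last Y) = t" "set X \<inter> set Y \<subseteq> {s, t} \<times> UNIV"
    using two_disjoint_tlines[of lam xs s t] xs avoid s_neq_t unfolding expands_def by auto
  have contract: "\<exists>P. temporal_path G lam s t P \<and> VT P \<subseteq> set Z"
    if Z: "tline G lam Z" "Z \<noteq> []" "hd Z = (s, 0)" "fst (last Z) = t" for Z
  proof -
    obtain vs ts where p: "temporal_path G lam s t (vs, ts)" "ts \<noteq> [] \<longrightarrow> VT (vs, ts) \<subseteq> set Z"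
      using temporal_path_of_tline[OF Z(1,2,4) t_vert] Z(3) by auto
    moreover have "ts \<noteq> []"
      using p(1) s_neq_t temporal_walk_ConsE[of G lam s t "(vs, ts)"] by (auto simp: temporal_path_def)
    ultimately show ?thesis by blast
  qed
  obtain A where A: "temporal_path G lam s t A" "VT A \<subseteq> set X" using contract[of X] XY by blast
  obtain B where B: "temporal_path G lam s t B" "VT B \<subseteq> set Y" using contract[of Y] XY by blast
  have dis: "VT A \<inter> VT B \<subseteq> {s, t} \<times> {1..\<tau>}" using A B XY(9) VT_subset[OF A(1)] by blast
  \<comment> \<open>\<open>pairwise\<close> compares only distinct elements, so distinctness is
    needed to count two paths.\<close>
  then have "A \<noteq> B" using VT_inner[OF A(1)] by blast
  have "path_packing G \<tau> lam s t {A, B}"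
    using A B dis by (auto simp: path_packing_def pairwise_def t_vertex_disjoint_def Int_commute)
  then show ?thesis using tp_ge[of "{A, B}"] \<open>A \<noteq> B\<close> by simp
qed

lemma tp_eq_1_iff: "tp G \<tau> lam s t = 1 \<longleftrightarrow> tpc G \<tau> lam s t = 1"
proof
  assume "tp G \<tau> lam s t = 1"
  then show "tpc G \<tau> lam s t = 1" using two_disjoint_paths tp_le_tpc by fastforce
next
  assume tpc: "tpc G \<tau> lam s t = 1"
  then have "\<not> t_vertex_cut G \<tau> lam s t {}" using tpc_le[of "{}"] by auto
  then obtain P where "temporal_path G lam s t P" by (auto simp: t_vertex_cut_def)
  then have "path_packing G \<tau> lam s t {P}" by (simp add: path_packing_def)
  then show "tp G \<tau> lam s t = 1" using tp_ge[of "{P}"] tp_le_tpc tpc by simp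
qed

end

lemma temporal_graph_imp_temporal_digraph:
  assumes "temporal_graph G \<tau> lam"
  shows "temporal_digraph G \<tau> lam"
proof -
  interpret temporal_graph G \<tau> lam by fact
  show ?thesis by unfold_locales (rule times)
qed

section \<open>Construction of the block graphs\<close>

section \<open>Graphs with a large gap\<close>

text \<open>
  The source is 0 and the sink 1.  The vertices \<open>entry i\<close> and \<open>inner i\<close> for \<open>i < 2 * k\<close> form \<open>k\<close>
  independent blocks, the pairs \<open>i, mate i\<close>.  Outside the one-vertex routes \<open>0, entry i, 1\<close> at
  time 2, a path has to enter a block at time 1, swap sides between the two inner vertices, and
  leave at time 3.  Two such paths of one block always meet, but no single temporal vertex lies
  on all of them: each block contributes 3 to \<open>tp\<close> and 4 to \<open>tpc\<close>.
\<close>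

definition entry :: "nat \<Rightarrow> nat" where "entry i = 2 + 2 * i"
definition inner :: "nat \<Rightarrow> nat" where "inner i = 3 + 2 * i"
definition mate :: "nat \<Rightarrow> nat" where "mate i = (if even i then Suc i else i - 1)"

definition gap_arc :: "nat \<Rightarrow> nat \<Rightarrow> nat \<Rightarrow> nat \<Rightarrow> bool" where
  "gap_arc k u v j \<longleftrightarrow> (\<exists>i < 2 * k.
     u = 0 \<and> v = entry i \<and> j \<in> {1, 2} \<or>
     u = entry i \<and> v = 1 \<and> j \<in> {2, 3} \<or>
     u = entry i \<and> v = inner i \<and> j \<in> {1, 3} \<or>
     u = inner i \<and> v = inner (mate i) \<and> j \<in> {1, 3})"

definition gap_lam :: "nat \<Rightarrow> nat \<times> nat \<Rightarrow> nat set" where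
  "gap_lam k = (\<lambda>(u, v). {j. gap_arc k u v j \<or> gap_arc k v u j})"

definition gap_graph :: "nat \<Rightarrow> nat pair_pre_digraph" where
  "gap_graph k = \<lparr>pverts = {..<4 * k + 2}, parcs = {e. gap_lam k e \<noteq> {}}\<rparr>"

lemma entry_inner_simps [simp]:
  "entry i = entry j \<longleftrightarrow> i = j" "inner i = inner j \<longleftrightarrow> i = j"
  "entry i \<noteq> inner j" "inner j \<noteq> entry i"
  "entry i \<noteq> 0" "0 \<noteq> entry i" "inner i \<noteq> 0" "0 \<noteq> inner i"
  "entry i \<noteq> Suc 0" "Suc 0 \<noteq> entry i" "inner i \<noteq> Suc 0" "Suc 0 \<noteq> inner i"
  unfolding entry_def inner_def by presburger+

lemma mate_simps [simp]: "mate (mate i) = i" "mate i \<noteq> i" "i \<noteq> mate i"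
  by (auto simp: mate_def elim: oddE)

lemma mate_less [simp]: "i < 2 * k \<Longrightarrow> mate i < 2 * k"
  unfolding mate_def by presburger

lemma same_div_2: "i div 2 = j div 2 \<Longrightarrow> j = i \<or> j = mate i"
  unfolding mate_def by presburger

lemma gap_lam_sym: "gap_lam k (u, v) = gap_lam k (v, u)"
  by (auto simp: gap_lam_def)

lemma gap_lam_source: "j \<in> gap_lam k (0, v) \<longleftrightarrow> (\<exists>i < 2 * k. v = entry i \<and> j \<in> {1, 2})"
  by (auto simp: gap_lam_def gap_arc_def)

lemma gap_lam_entry:
  assumes "i < 2 * k"
  shows "j \<in> gap_lam k (entry i, v) \<longleftrightarrow>
    v = 0 \<and> j \<in> {1, 2} \<or> v = 1 \<and> j \<in> {2, 3} \<or> v = inner i \<and> j \<in> {1, 3}"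
  using assms by (auto simp: gap_lam_def gap_arc_def)

lemma gap_lam_inner:
  assumes "i < 2 * k"
  shows "j \<in> gap_lam k (inner i, v) \<longleftrightarrow> v = entry i \<and> j \<in> {1, 3} \<or> v = inner (mate i) \<and> j \<in> {1, 3}"
  using assms by (auto simp: gap_lam_def gap_arc_def intro: exI[of _ "mate i"])

lemma gap_arc_bounds:
  assumes "gap_arc k u v j"
  shows "u < 4 * k + 2" "v < 4 * k + 2" "u \<noteq> v" "j \<in> {1..3}"
proof -
  obtain i where i: "i < 2 * k"
    and c: "u = 0 \<and> v = entry i \<and> j \<in> {1, 2} \<or> u = entry i \<and> v = 1 \<and> j \<in> {2, 3} \<or>
     u = entry i \<and> v = inner i \<and> j \<in> {1, 3} \<or> u = inner i \<and> v = inner (mate i) \<and> j \<in> {1, 3}"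
    using assms unfolding gap_arc_def by blast
  have "entry i < 4 * k + 2" "inner i < 4 * k + 2" "inner (mate i) < 4 * k + 2"
    using i mate_less[OF i] unfolding entry_def inner_def by presburger+
  then show "u < 4 * k + 2" "v < 4 * k + 2" "u \<noteq> v" "j \<in> {1..3}"
    using c by auto
qed

lemma temporal_graph_gap: "temporal_graph (gap_graph k) 3 (gap_lam k)"
proof -
  have arcs: "parcs (gap_graph k) \<subseteq> {..<4 * k + 2} \<times> {..<4 * k + 2}"
    using gap_arc_bounds by (fastforce simp: gap_graph_def gap_lam_def)
  have "finite (parcs (gap_graph k))" by (rule finite_subset[OF arcs]) simp
  moreover have "fst e < 4 * k + 2" "snd e < 4 * k + 2" if "e \<in> parcs (gap_graph k)" for e
    using subsetD[OF arcs that] by auto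
  moreover have "fst e \<noteq> snd e" "gap_lam k e \<subseteq> {1..3}" if "e \<in> parcs (gap_graph k)" for e
    using that gap_arc_bounds by (fastforce simp: gap_graph_def gap_lam_def)+
  moreover have "sym (parcs (gap_graph k))"
    using gap_lam_sym by (fastforce simp: sym_def gap_graph_def)
  ultimately show ?thesis
    by unfold_locales
      (auto simp: gap_graph_def gap_lam_sym symmetric_def)
qed

lemma gap_graph_simps [simp]:
  "pverts (gap_graph k) = {..<4 * k + 2}" "e \<in> parcs (gap_graph k) \<longleftrightarrow> gap_lam k e \<noteq> {}"
  by (auto simp: gap_graph_def)

lemma temporal_st_gap: "temporal_st (gap_graph k) 3 (gap_lam k) 0 1"
proof -
  interpret temporal_digraph "gap_graph k" 3 "gap_lam k"
    by (rule temporal_graph_imp_temporal_digraph[OF temporal_graph_gap])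
  show ?thesis
    by unfold_locales (auto simp: adjacent_def gap_lam_source gap_lam_sym[of k "Suc 0" 0])
qed

section \<open>Paths in the block graphs\<close>

definition direct_path :: "nat \<Rightarrow> nat twalk" where
  "direct_path i = ([0, entry i, 1], [2, 2])"

definition crossing_path :: "nat \<Rightarrow> nat \<Rightarrow> nat twalk" where
  "crossing_path i j =
     ([0, entry i, inner i, inner (mate i), entry (mate i), 1], [1, 1, j, 3, 3])"

lemma VT_direct: "VT (direct_path i) = {(0, 2), (entry i, 2), (1, 2)}"
  by (auto simp: direct_path_def VT_Cons VT_single)

lemma VT_crossing:
  assumes "j \<in> {1, 3}"
  shows "VT (crossing_path i j) = {(0, 1), (entry i, 1), (entry (mate i), 3), (1, 3)} \<union>
    {inner i} \<times> {1..j} \<union> {inner (mate i)} \<times> {j..3}"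
  using assms by (auto simp: crossing_path_def VT_Cons VT_single)

lemma path_direct:
  assumes "i < 2 * k"
  shows "temporal_path (gap_graph k) (gap_lam k) 0 1 (direct_path i)"
proof -
  have "2 \<in> gap_lam k (0, entry i)" "2 \<in> gap_lam k (entry i, 1)"
    using assms by (auto simp: gap_lam_source gap_lam_entry)
  moreover have "entry i < 4 * k + 2" using assms unfolding entry_def by presburger
  ultimately show ?thesis
    by (auto simp: direct_path_def temporal_path_def temporal_walk_Cons temporal_walk_Nil)
qed

lemma path_crossing:
  assumes i: "i < 2 * k" and j: "j \<in> {1, 3}"
  shows "temporal_path (gap_graph k) (gap_lam k) 0 1 (crossing_path i j)"
proof -
  have m: "mate i < 2 * k" using i by simp
  have "1 \<in> gap_lam k (0, entry i)" "1 \<in> gap_lam k (entry i, inner i)"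
    "j \<in> gap_lam k (inner i, inner (mate i))" "3 \<in> gap_lam k (inner (mate i), entry (mate i))"
    "3 \<in> gap_lam k (entry (mate i), 1)"
    using i j by (auto simp: gap_lam_source gap_lam_entry gap_lam_inner)
  moreover have "entry i < 4 * k + 2" "inner i < 4 * k + 2"
    "entry (mate i) < 4 * k + 2" "inner (mate i) < 4 * k + 2"
    using i m unfolding entry_def inner_def by presburger+
  ultimately show ?thesis using j
    by (auto simp: crossing_path_def temporal_path_def temporal_walk_Cons temporal_walk_Nil)
qed

text \<open>A path that is not at its first entry at time 2 must go on at time 1, and distinctness
  then forces the vertices of a crossing path. Only the times of the later edges remain free, which
  yields the alternatives.\<close>

lemma gap_path_cases:
  assumes "temporal_path (gap_graph k) (gap_lam k) 0 1 P"
  obtains i j where "i < 2 * k" "j \<in> {1, 2}" "(entry i, j) \<in> VT P"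
    "(entry i, 2) \<in> VT P \<or> (entry (mate i), 2) \<in> VT P \<or>
      (inner i, 1) \<in> VT P \<and> (inner (mate i), 3) \<in> VT P \<and>
      ((inner i, 3) \<in> VT P \<or> (inner (mate i), 1) \<in> VT P)"
proof -
  let ?w = "temporal_walk (gap_graph k) (gap_lam k)"
  obtain v1 vs1 t1 ts1 where P1: "P = (0 # v1 # vs1, t1 # ts1)"
    using assms temporal_walk_ConsE[of _ _ 0 1 P] unfolding temporal_path_def by (metis zero_neq_one)
  have d1: "distinct (0 # v1 # vs1)" using assms P1 by (simp add: temporal_path_def)
  have w1: "t1 \<in> gap_lam k (0, v1)" "\<forall>b \<in> set ts1. t1 \<le> b" "?w v1 1 (v1 # vs1, ts1)"
    using assms P1 by (auto simp: temporal_path_def temporal_walk_Cons)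
  then obtain i where i: "i < 2 * k" "v1 = entry i" "t1 \<in> {1, 2}" by (auto simp: gap_lam_source)
  have m: "mate i < 2 * k" using i by simp
  obtain v2 vs2 t2 ts2 where P2: "(v1 # vs1, ts1) = (v1 # v2 # vs2, t2 # ts2)"
    by (rule temporal_walk_ConsE[OF w1(3)]) (simp add: i, rule that)
  then have w2: "t2 \<in> gap_lam k (entry i, v2)" "t1 \<le> t2" "\<forall>b \<in> set ts2. t2 \<le> b"
    "?w v2 1 (v2 # vs2, ts2)"
    using w1 i by (auto simp: temporal_walk_Cons)
  have VT2: "VT P = {(0, t1)} \<union> {entry i} \<times> {t1..t2} \<union> VT (entry i # v2 # vs2, t2 # ts2)"
    using P1 P2 i w2(2) by (simp add: VT_Cons)
  have e: "(entry i, t1) \<in> VT P" using VT2 w2(2) by auto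
  show ?thesis
  proof (cases "t1 = 2 \<or> 2 \<le> t2")
    case True
    then have "(entry i, 2) \<in> VT P" using VT2 i(3) w2(2) by auto
    then show ?thesis using that[of i 2] i by blast
  next
    case False
    then have t1: "t1 = 1" and v2: "v2 = inner i" and t2: "t2 = 1"
      using i w2 d1 P2 by (auto simp: gap_lam_entry)
    obtain v3 vs3 t3 ts3 where P3: "(v2 # vs2, ts2) = (v2 # v3 # vs3, t3 # ts3)"
      by (rule temporal_walk_ConsE[OF w2(4)]) (simp add: v2, rule that)
    then have w3: "t3 \<in> gap_lam k (inner i, v3)" "t2 \<le> t3" "\<forall>b \<in> set ts3. t3 \<le> b"
      "?w v3 1 (v3 # vs3, ts3)"
      using w2 v2 by (auto simp: temporal_walk_Cons)
    have v3: "v3 = inner (mate i)" and t3: "t3 \<in> {1, 3}"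
      using w3(1) i d1 P2 P3 v2 by (auto simp: gap_lam_inner)
    obtain v4 vs4 t4 ts4 where P4: "(v3 # vs3, ts3) = (v3 # v4 # vs4, t4 # ts4)"
      by (rule temporal_walk_ConsE[OF w3(4)]) (simp add: v3, rule that)
    then have w4: "t4 \<in> gap_lam k (inner (mate i), v4)" "t3 \<le> t4" "\<forall>b \<in> set ts4. t4 \<le> b"
      "?w v4 1 (v4 # vs4, ts4)"
      using w3 v3 by (auto simp: temporal_walk_Cons)
    have v4: "v4 = entry (mate i)" and t4: "t4 \<in> {1, 3}"
      using w4(1) m d1 P2 P3 P4 v2 v3 by (auto simp: gap_lam_inner)
    obtain v5 vs5 t5 ts5 where P5: "(v4 # vs4, ts4) = (v4 # v5 # vs5, t5 # ts5)"
      by (rule temporal_walk_ConsE[OF w4(4)]) (simp add: v4, rule that)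
    then have w5: "t5 \<in> gap_lam k (entry (mate i), v5)" "t4 \<le> t5"
      using w4 v4 by (auto simp: temporal_walk_Cons)
    have t5: "t5 \<in> {2, 3}"
      using w5(1) m d1 P2 P3 P4 P5 v2 v3 v4 by (auto simp: gap_lam_entry)
    have "{inner i} \<times> {1..t3} \<union> {inner (mate i)} \<times> {t3..t4} \<union> {entry (mate i)} \<times> {t4..t5} \<subseteq> VT P"
      using VT2 P2 P3 P4 P5 t2 v2 v3 v4 w3(2) w4(2) w5(2) by (simp add: VT_Cons) blast
    then have V: "1 \<le> j \<Longrightarrow> j \<le> t3 \<Longrightarrow> (inner i, j) \<in> VT P"
      "t3 \<le> j \<Longrightarrow> j \<le> t4 \<Longrightarrow> (inner (mate i), j) \<in> VT P"
      "t4 \<le> j \<Longrightarrow> j \<le> t5 \<Longrightarrow> (entry (mate i), j) \<in> VT P" for j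
      by auto
    \<comment> \<open>If \<open>t4 = 1\<close>, the stay at \<open>entry (mate i)\<close> covers
      time 2. Otherwise \<open>t4 = 3\<close>, and the swap at \<open>t3 = 3\<close> or
      \<open>t3 = 1\<close> decides which inner vertex is occupied from time 1 to 3.\<close>
    have "(entry (mate i), 2) \<in> VT P \<or>
      (inner i, 1) \<in> VT P \<and> (inner (mate i), 3) \<in> VT P \<and>
      ((inner i, 3) \<in> VT P \<or> (inner (mate i), 1) \<in> VT P)"
      using V(1)[of 1] V(1)[of 3] V(2)[of 1] V(2)[of 3] V(3)[of 2] t3 t4 t5 w4(2) by auto
    then show ?thesis using that[of i 1] i e t1 by simp
  qed
qed

section \<open>Values of \<open>tp\<close> and \<open>tpc\<close> on the block graphs\<close>

lemma (in temporal_st) packing_eqI: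
  assumes "path_packing G \<tau> lam s t F" "P \<in> F" "Q \<in> F" "(v, j) \<in> VT P" "(v, j) \<in> VT Q" "v \<noteq> s" "v \<noteq> t"
  shows "P = Q"
proof (rule ccontr)
  assume "P \<noteq> Q"
  then have "VT P \<inter> VT Q \<subseteq> {s, t} \<times> {1..\<tau>}"
    using assms(1-3) by (auto simp: path_packing_def pairwise_def t_vertex_disjoint_def)
  then show False using assms(4-7) by blast
qed

text \<open>In a packing, at most \<open>2 * k\<close> paths use some \<open>(entry i, 2)\<close>,
  and the others lie in different blocks. All direct paths together with one crossing path per block
  attain the bound.\<close>

lemma tp_gap: "tp (gap_graph k) 3 (gap_lam k) 0 1 = 3 * k"
proof -
  interpret temporal_st "gap_graph k" 3 "gap_lam k" 0 1 by (rule temporal_st_gap)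
  obtain F where F: "path_packing (gap_graph k) 3 (gap_lam k) 0 1 F"
    and cF: "card F = tp (gap_graph k) 3 (gap_lam k) 0 1" by (rule tp_packing)
  note eqI = packing_eqI[OF F]
  define F1 where "F1 = {P \<in> F. \<exists>i < 2 * k. (entry i, 2) \<in> VT P}"
  have "\<forall>P \<in> F1. \<exists>i. i < 2 * k \<and> (entry i, 2) \<in> VT P" unfolding F1_def by blast
  then obtain f where f: "\<forall>P \<in> F1. f P < 2 * k \<and> (entry (f P), 2) \<in> VT P" by metis
  have "inj_on f F1"
  proof (rule inj_onI)
    fix P Q assume PQ: "P \<in> F1" "Q \<in> F1" "f P = f Q"
    then show "P = Q" using bspec[OF f PQ(1)] bspec[OF f PQ(2)] eqI[of P Q "entry (f P)" 2]
      by (simp add: F1_def)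
  qed
  then have "card F1 \<le> card {..<2 * k}" using f by (intro card_inj_on_le[of f]) auto
  then have c1: "card F1 \<le> 2 * k" by simp
  have "\<exists>i. i < 2 * k \<and> (inner i, 1) \<in> VT P \<and> (inner (mate i), 3) \<in> VT P \<and>
      ((inner i, 3) \<in> VT P \<or> (inner (mate i), 1) \<in> VT P)" if "P \<in> F - F1" for P
  proof -
    have "temporal_path (gap_graph k) (gap_lam k) 0 1 P" using F that by (simp add: path_packing_def)
    then show ?thesis
      by (rule gap_path_cases) (use that mate_less in \<open>unfold F1_def, blast\<close>)
  qed
  then obtain g where g: "\<And>P. P \<in> F - F1 \<Longrightarrow> g P < 2 * k \<and> (inner (g P), 1) \<in> VT P \<and>
      (inner (mate (g P)), 3) \<in> VT P \<and>
      ((inner (g P), 3) \<in> VT P \<or> (inner (mate (g P)), 1) \<in> VT P)" by metis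
  \<comment> \<open>\<open>g P div 2\<close> is the block. Two paths entering on the same side share
    \<open>(inner (g P), 1)\<close>; for opposite sides, whichever of
    \<open>(inner (g P), 3)\<close> and \<open>(inner (mate (g P)), 1)\<close> lies on
    \<open>P\<close> also lies on \<open>Q\<close>.\<close>
  have "inj_on (\<lambda>P. g P div 2) (F - F1)"
  proof (rule inj_onI)
    fix P Q assume PQ: "P \<in> F - F1" "Q \<in> F - F1" "g P div 2 = g Q div 2"
    have e: "P = Q" if "(inner i, j) \<in> VT P" "(inner i, j) \<in> VT Q" for i j
      using eqI[of P Q "inner i" j] PQ that by simp
    have "g Q = g P \<or> g Q = mate (g P)" by (rule same_div_2[OF PQ(3)])
    then show "P = Q" using g[OF PQ(1)] g[OF PQ(2)] by (auto intro: e)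
  qed
  moreover have "g P div 2 < k" if "P \<in> F - F1" for P using g[OF that] by linarith
  ultimately have "card (F - F1) \<le> card {..<k}"
    by (intro card_inj_on_le[of "\<lambda>P. g P div 2"]) auto
  moreover have "card F = card F1 + card (F - F1)"
    using finite_packing[OF F] by (subst card_Diff_subset) (auto simp: F1_def card_mono intro: finite_subset)
  ultimately have le: "tp (gap_graph k) 3 (gap_lam k) 0 1 \<le> 3 * k" using c1 cF by simp
  define H where "H = direct_path ` {..<2 * k} \<union> (\<lambda>c. crossing_path (2 * c) 1) ` {..<k}"
  have H_path: "temporal_path (gap_graph k) (gap_lam k) 0 1 P" if "P \<in> H" for P
    using that path_direct path_crossing unfolding H_def by auto
  \<comment> \<open>Recovers the path of \<open>H\<close> from any of its temporal vertices off
    source and sink: even \<open>v\<close> are entries, used at time 2 only by direct paths, and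
    \<open>(v - 2) div 4\<close> is the block.\<close>
  define owner where "owner = (\<lambda>(v :: nat, j :: nat).
    if even v \<and> j = 2 then direct_path ((v - 2) div 2) else crossing_path (2 * ((v - 2) div 4)) 1)"
  have owner: "P = owner x" if "P \<in> H" "x \<in> VT P" "fst x \<notin> {0, 1}" for P x
  proof -
    have "Suc (4 * c) div 4 = c" "Suc (Suc (4 * c)) div 4 = c" for c :: nat by presburger+
    then show ?thesis
      using that by (auto simp: H_def VT_direct VT_crossing mate_def owner_def entry_def inner_def)
  qed
  have "pairwise (t_vertex_disjoint 3 0 1) H"
  proof (rule pairwiseI)
    fix P Q assume PQ: "P \<in> H" "Q \<in> H" "P \<noteq> Q"
    have "x \<in> {0, 1} \<times> {1..3}" if x: "x \<in> VT P" "x \<in> VT Q" for x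
    proof -
      have "fst x \<in> {0, 1}" using owner[OF PQ(1) x(1)] owner[OF PQ(2) x(2)] PQ(3) by blast
      moreover have "snd x \<in> {1..3}" using VT_subset[OF H_path[OF PQ(1)]] x(1) by auto
      ultimately show ?thesis by (metis SigmaI prod.collapse)
    qed
    then show "t_vertex_disjoint 3 0 1 P Q" unfolding t_vertex_disjoint_def by blast
  qed
  then have "card H \<le> tp (gap_graph k) 3 (gap_lam k) 0 1"
    using H_path by (intro tp_ge) (simp add: path_packing_def)
  moreover have "card H = 2 * k + k"
  proof -
    have "inj_on direct_path {..<2 * k}" "inj_on (\<lambda>c. crossing_path (2 * c) 1) {..<k}"
      by (auto simp: inj_on_def direct_path_def crossing_path_def)
    moreover have "direct_path ` {..<2 * k} \<inter> (\<lambda>c. crossing_path (2 * c) 1) ` {..<k} = {}"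
      by (auto simp: direct_path_def crossing_path_def)
    ultimately show ?thesis unfolding H_def by (simp add: card_Un_disjoint card_image)
  qed
  ultimately show ?thesis using le by simp
qed

text \<open>All entries at times 1 and 2 form a cut. Conversely, the direct paths force every
  \<open>(entry i, 2)\<close> into a cut, and the crossing paths force two further elements in each
  block.\<close>

lemma tpc_gap: "tpc (gap_graph k) 3 (gap_lam k) 0 1 = 4 * k"
proof -
  interpret temporal_st "gap_graph k" 3 "gap_lam k" 0 1 by (rule temporal_st_gap)
  define E where "E = entry ` {..<2 * k} \<times> {1, 2 :: nat}"
  have "card E = 4 * k" by (simp add: E_def card_cartesian_product card_image inj_on_def)
  moreover have "t_vertex_cut (gap_graph k) 3 (gap_lam k) 0 1 E"
  proof -
    have "entry i < 4 * k + 2" if "i < 2 * k" for i using that unfolding entry_def by presburger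
    then have "E \<subseteq> (pverts (gap_graph k) - {0, 1}) \<times> {1..3}" by (auto simp: E_def)
    moreover have "E \<inter> VT P \<noteq> {}" if "temporal_path (gap_graph k) (gap_lam k) 0 1 P" for P
      using that by (rule gap_path_cases) (auto simp: E_def)
    ultimately show ?thesis by (simp add: t_vertex_cut_def)
  qed
  ultimately have le: "tpc (gap_graph k) 3 (gap_lam k) 0 1 \<le> 4 * k" using tpc_le by fastforce
  obtain S where S: "t_vertex_cut (gap_graph k) 3 (gap_lam k) 0 1 S"
    and cS: "card S = tpc (gap_graph k) 3 (gap_lam k) 0 1" by (rule tpc_cut)
  have S_inner: "v \<noteq> 0" "v \<noteq> 1" if "(v, j) \<in> S" for v j
    using S that by (auto simp: t_vertex_cut_def)
  have hit: "S \<inter> VT P \<noteq> {}" if "temporal_path (gap_graph k) (gap_lam k) 0 1 P" for P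
    using S that unfolding t_vertex_cut_def by blast
  define D where "D = entry ` {..<2 * k} \<times> {2 :: nat}"
  have D: "D \<subseteq> S"
  proof
    fix x assume "x \<in> D"
    then obtain i where i: "i < 2 * k" "x = (entry i, 2)" by (auto simp: D_def)
    then show "x \<in> S" using hit[OF path_direct[OF i(1)]] S_inner unfolding VT_direct by auto
  qed
  have cD: "card D = 2 * k" by (simp add: D_def card_cartesian_product card_image inj_on_def)
  define blk where "blk x = (fst x - 2) div 4" for x :: "nat \<times> nat"
  have two: "\<exists>p q. p \<noteq> q \<and> p \<in> S - D \<and> q \<in> S - D \<and> blk p = c \<and> blk q = c" if c: "c < k" for c
  proof -
    let ?i = "2 * c" and ?m = "Suc (2 * c)"
    have m: "mate ?i = ?m" "mate ?m = ?i" by (auto simp: mate_def)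
    define W where "W i j = {(entry i, 1), (entry (mate i), 3)} \<union> {inner i} \<times> {1..j} \<union>
      {inner (mate i)} \<times> {j..3 :: nat}" for i j
    have "\<exists>e. e \<in> S \<inter> W i j" if "i < 2 * k" "j \<in> {1, 3}" for i j
      using hit[OF path_crossing[OF that]] S_inner unfolding VT_crossing[OF that(2)] W_def by blast
    then obtain e1 e2 e3 e4 where e: "e1 \<in> S \<inter> W ?i 1" "e2 \<in> S \<inter> W ?i 3"
      "e3 \<in> S \<inter> W ?m 1" "e4 \<in> S \<inter> W ?m 3"
      using c by (metis insertCI m(1) mate_less mult_less_cancel1 zero_less_numeral)
    \<comment> \<open>The four crossing paths of a block, two directions with two swap times each,
      have no inner temporal vertex in common.\<close>
    have "\<not> (e2 = e1 \<and> e3 = e1 \<and> e4 = e1)" using e by (auto simp: W_def m)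
    moreover have "x \<in> S - D \<and> blk x = c" if "x \<in> S \<inter> W i j" "i \<in> {?i, ?m}" "j \<in> {1, 3}" for x i j
    proof -
      have "x \<notin> D" using that by (auto simp: W_def D_def m)
      moreover have "blk x = c" using that by (auto simp: W_def blk_def m entry_def inner_def)
      ultimately show ?thesis using that(1) by blast
    qed
    then have "\<forall>x \<in> {e1, e2, e3, e4}. x \<in> S - D \<and> blk x = c" using e by blast
    ultimately show ?thesis by (metis insertCI)
  qed
  then obtain p q where pq: "\<And>c. c < k \<Longrightarrow> p c \<noteq> q c \<and> p c \<in> S - D \<and> q c \<in> S - D \<and> blk (p c) = c \<and> blk (q c) = c"
    by metis
  have "inj_on p {..<k}" "inj_on q {..<k}" by (rule inj_onI; metis lessThan_iff pq)+
  moreover have "p ` {..<k} \<inter> q ` {..<k} = {}" using pq by (auto; metis)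
  ultimately have "card (p ` {..<k} \<union> q ` {..<k}) = 2 * k" by (simp add: card_Un_disjoint card_image)
  moreover have "D \<inter> (p ` {..<k} \<union> q ` {..<k}) = {}" using pq by auto
  moreover have "finite D" by (simp add: D_def)
  ultimately have "card (D \<union> (p ` {..<k} \<union> q ` {..<k})) = 4 * k"
    using cD by (subst card_Un_disjoint) auto
  moreover have "D \<union> (p ` {..<k} \<union> q ` {..<k}) \<subseteq> S" using D pq by auto
  ultimately have "4 * k \<le> card S" using finite_cut[OF S] card_mono by metis
  then show ?thesis using le cS by simp
qed

theorem theorem1:
  shows "(\<forall>(G :: 'a pair_pre_digraph) \<tau> lam s t.
            (temporal_graph G \<tau> lam \<or> temporal_digraph G \<tau> lam) \<and>
            s \<in> pverts G \<and> t \<in> pverts G \<and> s \<noteq> t \<and> \<not> adjacent G s t \<longrightarrow>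
            (tp G \<tau> lam s t = 1 \<longleftrightarrow> tpc G \<tau> lam s t = 1)) \<and>
         (\<forall>k::nat. k \<ge> 2 \<longrightarrow>
            (\<exists>(G :: nat pair_pre_digraph) \<tau> lam s t.
               temporal_graph G \<tau> lam \<and>
               s \<in> pverts G \<and> t \<in> pverts G \<and> s \<noteq> t \<and> \<not> adjacent G s t \<and>
               tpc G \<tau> lam s t = k + tp G \<tau> lam s t) \<and>
            (\<exists>(G :: nat pair_pre_digraph) \<tau> lam s t.
               temporal_digraph G \<tau> lam \<and>
               s \<in> pverts G \<and> t \<in> pverts G \<and> s \<noteq> t \<and> \<not> adjacent G s t \<and>
               tpc G \<tau> lam s t = k + tp G \<tau> lam s t))"
proof (intro conjI allI impI)
  fix G :: "'a pair_pre_digraph" and \<tau> lam s t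
  assume a: "(temporal_graph G \<tau> lam \<or> temporal_digraph G \<tau> lam) \<and>
    s \<in> pverts G \<and> t \<in> pverts G \<and> s \<noteq> t \<and> \<not> adjacent G s t"
  then have "temporal_digraph G \<tau> lam" using temporal_graph_imp_temporal_digraph by blast
  then interpret temporal_st G \<tau> lam s t
    using a by (auto simp: temporal_st_def temporal_st_axioms_def)
  show "tp G \<tau> lam s t = 1 \<longleftrightarrow> tpc G \<tau> lam s t = 1" by (rule tp_eq_1_iff)
next
  fix k :: nat
  interpret temporal_st "gap_graph k" 3 "gap_lam k" 0 1 by (rule temporal_st_gap)
  have gap: "tpc (gap_graph k) 3 (gap_lam k) 0 1 = k + tp (gap_graph k) 3 (gap_lam k) 0 1"
    unfolding tp_gap tpc_gap by simp
  show "\<exists>(G :: nat pair_pre_digraph) \<tau> lam s t. temporal_graph G \<tau> lam \<and>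
      s \<in> pverts G \<and> t \<in> pverts G \<and> s \<noteq> t \<and> \<not> adjacent G s t \<and>
      tpc G \<tau> lam s t = k + tp G \<tau> lam s t"
    using temporal_graph_gap s_vert t_vert s_neq_t not_adj gap by blast
  \<comment> \<open>The symmetric digraph representing the undirected example is itself a directed
    example.\<close>
  show "\<exists>(G :: nat pair_pre_digraph) \<tau> lam s t. temporal_digraph G \<tau> lam \<and>
      s \<in> pverts G \<and> t \<in> pverts G \<and> s \<noteq> t \<and> \<not> adjacent G s t \<and>
      tpc G \<tau> lam s t = k + tp G \<tau> lam s t"
    using temporal_digraph_axioms s_vert t_vert s_neq_t not_adj gap by blast
qed

end
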